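(* Let $g$ be a metric on the pullback tangent bundle $\pi^*(TM)\to E$. There is only one Finsler connection $\nabla$ with the following properties: ($\tilde\alpha$) $\nabla$ is regular; ($\tilde\beta$) $T=0$ (no horizontal torsion); ($\tilde\gamma$) $y^aDg_{ab}=0$ (positive homogeneity); ($\tilde\delta$) $Dg_{ab}\wedge Dy^b=0$ for every $a$ (almost metric compatibility). Moreover, under these conditions $g$ is the vertical Hessian of a function $\mathscr{L}\colon E\to\mathbb{R}$ positive homogeneous of degree 2, and the connection is the Chern connection (of $\mathscr{L}$). Finally, these results do not change if ($\tilde\delta$) is replaced by ($\tilde\delta'$) $y^aD^2g_{ab}=0$.
   Context: Setting. $M$ is a connected smooth $n$-dimensional manifold, $E=TM\setminus 0$ its slit tangent bundle, $\pi\colon E\to M$ the projection; all objects are smooth. A metric $g$ is a symmetric non-degenerate (of any signature) section of $\pi^*(T^*M\otimes_M T^*M)$ over $E$. A Finsler connection is a Koszul (linear) connection $\nabla$ on the vector bundle $\pi^*(TM)\to E$. It extends to pullback tensor bundles and defines the covariant exterior differential $D$ on forms on $E$ with values in pullback tensor bundles, by $D(S\otimes\beta)=\nabla S\wedge\beta+S\otimes d\beta$. Local coordinates $\{x^a\}$ on $M$ induce $\{x^a,y^a\}$ on $E$; $e_a=\partial/\partial x^a$, $e^a=dx^a$. The connection 1-forms $\omega^a{}_b$ on $E$ are defined by $\nabla e_b=\omega^a{}_be_a$. The Liouville section is $y=y^ae_a$ (its value at $X\in E$ is $X$). Set $\omega=\omega^ae_a$ with $\omega^a=\pi^*dx^a$,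 and $\bar\omega=Dy$, with components $\bar\omega^a=Dy^a=dy^a+\omega^a{}_by^b$. $Dg_{ab}=dg_{ab}-\omega^c{}_ag_{cb}-\omega^c{}_bg_{ac}$ denotes the components of $Dg$, and $D^2g_{ab}$ those of $D(Dg)$. The horizontal torsion is $T=D\omega$, $T^a=\omega^a{}_b\wedge\omega^b$. $VE=\ker\pi_*$ is the vertical bundle. $\nabla$ is regular if for every $X\in E$ the map $V_XE\to T_{\pi(X)}M$, $Z\mapsto\nabla_Zy$, is injective (equivalently $\{\omega^a,\bar\omega^a\}$ is a basis of $T^*E$ at each point). For regular $\nabla$, write uniquely $\omega^a{}_b=H^a{}_{bc}\omega^c+V^a{}_{bc}\bar\omega^c$. "$g$ is the vertical Hessian of $\mathscr{L}$" means $g_{ab}=\partial^2\mathscr{L}/\partial y^a\partial y^b$; positive homogeneous of degree 2 means $\mathscr{L}(sy)=s^2\mathscr{L}(y)$ for all $s>0$. For such $\mathscr{L}$ (with $g$ non-degenerate), let $2G^a=g^{ad}\big(\frac{\partial^2\mathscr{L}}{\partial x^c\partial y^d}y^c-\frac{\partial\mathscr{L}}{\partial x^d}\big)$, $N^a_c=\partial G^a/\partial y^c$ (Barthel non-linear connection), $\frac{\delta}{\delta x^a}=\frac{\partial}{\partial x^a}-N^b_a\frac{\partial}{\partial y^b}$, and $\Gamma^a{}_{bc}=\tfrac12g^{an}\big[\tfrac{\delta}{\delta x^b}g_{nc}+\tfrac{\delta}{\delta x^c}g_{nb}-\tfrac{\delta}{\delta x^n}g_{bc}\big]$. The Chern connection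 of $\mathscr{L}$ is the Finsler connection with $H^a{}_{bc}=\Gamma^a{}_{bc}$, $V^a{}_{bc}=0$, i.e. $\omega^a{}_b=\Gamma^a{}_{bc}dx^c$. *)

theory Defs
  imports "HOL-Analysis.Analysis"
begin

section \<open>Smooth maps between open sets of Euclidean spaces\<close>

primrec Ck_on :: "nat \<Rightarrow> 'a::euclidean_space set \<Rightarrow> ('a \<Rightarrow> 'b::real_normed_vector) \<Rightarrow> bool" where
  "Ck_on 0 S f \<longleftrightarrow> continuous_on S f"
| "Ck_on (Suc k) S f \<longleftrightarrow>
     f differentiable_on S \<and> (\<forall>v. Ck_on k S (\<lambda>x. frechet_derivative f (at x) v))"

definition smooth_on :: "'a::euclidean_space set \<Rightarrow> ('a \<Rightarrow> 'b::real_normed_vector) \<Rightarrow> bool" where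
  "smooth_on S f \<longleftrightarrow> (\<forall>k. Ck_on k S f)"


section \<open>Smooth manifolds\<close>

text \<open>
  A chart is a pair (domain, coordinate map); the values of the map off the domain are
  irrelevant.  A manifold is given by an atlas (not necessarily maximal), whose chart
  domains cover it and whose charts generate its topology.
\<close>

type_synonym ('p, 'e) chart = "'p set \<times> ('p \<Rightarrow> 'e)"

definition chart_inv :: "('p, 'e) chart \<Rightarrow> 'e \<Rightarrow> 'p" where
  "chart_inv c = inv_into (fst c) (snd c)"

definition transition :: "('p, 'e) chart \<Rightarrow> ('p, 'e) chart \<Rightarrow> 'e \<Rightarrow> 'e" where
  "transition c c' = snd c' \<circ> chart_inv c"

definition points :: "('p, 'e) chart set \<Rightarrow> 'p set" where
  "points A = \<Union> (fst ` A)"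

definition charts_at :: "('p, 'e) chart set \<Rightarrow> 'p \<Rightarrow> ('p, 'e) chart set" where
  "charts_at A p = {c \<in> A. p \<in> fst c}"

definition smooth_atlas :: "('p, 'e::euclidean_space) chart set \<Rightarrow> bool" where
  "smooth_atlas A \<longleftrightarrow>
     (\<forall>c\<in>A. inj_on (snd c) (fst c)) \<and>
     (\<forall>c\<in>A. \<forall>c'\<in>A. open (snd c ` (fst c \<inter> fst c')) \<and>
                     smooth_on (snd c ` (fst c \<inter> fst c')) (transition c c'))"

definition manifold_topology :: "('p, 'e::euclidean_space) chart set \<Rightarrow> 'p topology" where
  "manifold_topology A =
     topology (\<lambda>W. W \<subseteq> points A \<and> (\<forall>c\<in>A. open (snd c ` (W \<inter> fst c))))"

lemma openin_manifold_topology: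
  assumes "smooth_atlas A"
  shows "openin (manifold_topology A) W \<longleftrightarrow>
           W \<subseteq> points A \<and> (\<forall>c\<in>A. open (snd c ` (W \<inter> fst c)))"
proof -
  have "istopology (\<lambda>W. W \<subseteq> points A \<and> (\<forall>c\<in>A. open (snd c ` (W \<inter> fst c))))"
    unfolding istopology_def
  proof (intro conjI allI impI ballI)
    fix S T c
    assume S: "S \<subseteq> points A \<and> (\<forall>c\<in>A. open (snd c ` (S \<inter> fst c)))"
      and T: "T \<subseteq> points A \<and> (\<forall>c\<in>A. open (snd c ` (T \<inter> fst c)))" and c: "c \<in> A"
    have "inj_on (snd c) (fst c)"
      using assms c by (auto simp: smooth_atlas_def)
    then have "snd c ` (S \<inter> T \<inter> fst c) = snd c ` (S \<inter> fst c) \<inter> snd c ` (T \<inter> fst c)"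
      by (auto simp: inj_on_def image_iff)
    then show "open (snd c ` (S \<inter> T \<inter> fst c))"
      using S T c by auto
  next
    fix K c
    assume K: "\<forall>S\<in>K. S \<subseteq> points A \<and> (\<forall>c\<in>A. open (snd c ` (S \<inter> fst c)))" and c: "c \<in> A"
    have "snd c ` (\<Union> K \<inter> fst c) = (\<Union>S\<in>K. snd c ` (S \<inter> fst c))"
      by auto
    then show "open (snd c ` (\<Union> K \<inter> fst c))"
      using K c by auto
  qed auto
  then show ?thesis
    by (simp add: manifold_topology_def topology_inverse')
qed

definition connected_manifold :: "('p, 'e::euclidean_space) chart set \<Rightarrow> bool" where
  "connected_manifold A \<longleftrightarrow>
     smooth_atlas A \<and> Hausdorff_space (manifold_topology A) \<and>
     second_countable (manifold_topology A) \<and> connected_space (manifold_topology A)"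

text \<open>
  A tangent vector at p assigns to each chart around p its components in that chart, in a way
  compatible with the Jacobians of the transition maps (and the value 0 to all other charts, so
  that equality of tangent vectors is equality of functions).
\<close>

type_synonym ('p, 'e) tvec = "('p, 'e) chart \<Rightarrow> 'e"

definition tangent_space ::
    "('p, 'e::euclidean_space) chart set \<Rightarrow> 'p \<Rightarrow> ('p, 'e) tvec set" where
  "tangent_space A p =
     {v. (\<forall>c\<in>charts_at A p. \<forall>c'\<in>charts_at A p.
            v c' = frechet_derivative (transition c c') (at (snd c p)) (v c)) \<and>
         (\<forall>c. c \<notin> charts_at A p \<longrightarrow> v c = 0)}"

definition tv_zero :: "('p, 'e::euclidean_space) tvec" where
  "tv_zero = (\<lambda>c. 0)"

definition tv_add :: "('p, 'e::euclidean_space) tvec \<Rightarrow> ('p, 'e) tvec \<Rightarrow> ('p, 'e) tvec" where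
  "tv_add v w = (\<lambda>c. v c + w c)"

definition tv_scale :: "real \<Rightarrow> ('p, 'e::euclidean_space) tvec \<Rightarrow> ('p, 'e) tvec" where
  "tv_scale r v = (\<lambda>c. r *\<^sub>R v c)"

text \<open>The tangent vector at p whose components in the chart c are u.\<close>

definition tangent_of ::
    "('p, 'e::euclidean_space) chart set \<Rightarrow> ('p, 'e) chart \<Rightarrow> 'p \<Rightarrow> 'e \<Rightarrow> ('p, 'e) tvec" where
  "tangent_of A c p u =
     (\<lambda>c'. if c' \<in> charts_at A p
            then frechet_derivative (transition c c') (at (snd c p)) u else 0)"

text \<open>The derivative of f at p along v; it does not depend on the chart selected.\<close>

definition differential ::
    "('p, 'e::euclidean_space) chart set \<Rightarrow> ('p \<Rightarrow> 'b::real_normed_vector) \<Rightarrow> 'p \<Rightarrow>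
     ('p, 'e) tvec \<Rightarrow> 'b" where
  "differential A f p v =
     (let c = (SOME c. c \<in> charts_at A p)
      in frechet_derivative (f \<circ> chart_inv c) (at (snd c p)) (v c))"

definition pushforward ::
    "('p, 'e::euclidean_space) chart set \<Rightarrow> ('q, 'f::euclidean_space) chart set \<Rightarrow> ('p \<Rightarrow> 'q) \<Rightarrow>
     'p \<Rightarrow> ('p, 'e) tvec \<Rightarrow> ('q, 'f) tvec" where
  "pushforward A B F p v =
     (\<lambda>c'. if c' \<in> charts_at B (F p) then differential A (snd c' \<circ> F) p v else 0)"

definition smooth_fun ::
    "('p, 'e::euclidean_space) chart set \<Rightarrow> 'p set \<Rightarrow> ('p \<Rightarrow> real) \<Rightarrow> bool" where
  "smooth_fun A W f \<longleftrightarrow> (\<forall>c\<in>A. smooth_on (snd c ` (W \<inter> fst c)) (f \<circ> chart_inv c))"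

definition smooth_vector_field ::
    "('p, 'e::euclidean_space) chart set \<Rightarrow> 'p set \<Rightarrow> ('p \<Rightarrow> ('p, 'e) tvec) \<Rightarrow> bool" where
  "smooth_vector_field A W Z \<longleftrightarrow>
     (\<forall>p\<in>W. Z p \<in> tangent_space A p) \<and>
     (\<forall>c\<in>A. smooth_on (snd c ` (W \<inter> fst c)) (\<lambda>x. Z (chart_inv c x) c))"


section \<open>The slit tangent bundle and the pullback tangent bundle\<close>

text \<open>A point of E is a pair (p, v) with v a nonzero tangent vector at p; so the projection
  is \<^term>\<open>fst\<close>.\<close>

type_synonym ('m, 'n) spoint = "'m \<times> ('m, real^'n) tvec"

definition slit_bundle :: "('m, real^'n) chart set \<Rightarrow> ('m, 'n) spoint set" where
  "slit_bundle A = {(p, v). p \<in> points A \<and> v \<in> tangent_space A p \<and> v \<noteq> tv_zero}"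

text \<open>The chart of E with coordinates (x, y) induced by a chart of M with coordinates x.\<close>

definition bundle_chart ::
    "('m, real^'n) chart set \<Rightarrow> ('m, real^'n) chart \<Rightarrow>
     (('m, 'n) spoint, (real^'n) \<times> (real^'n)) chart" where
  "bundle_chart A c = ({X \<in> slit_bundle A. fst X \<in> fst c}, \<lambda>X. (snd c (fst X), snd X c))"

definition slit_atlas ::
    "('m, real^'n) chart set \<Rightarrow> (('m, 'n) spoint, (real^'n) \<times> (real^'n)) chart set" where
  "slit_atlas A = bundle_chart A ` A"

abbreviation slit_topology :: "('m, real^'n) chart set \<Rightarrow> ('m, 'n) spoint topology" where
  "slit_topology A \<equiv> manifold_topology (slit_atlas A)"

type_synonym ('m, 'n) svec = "(('m, 'n) spoint, (real^'n) \<times> (real^'n)) tvec"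

definition vertical_space :: "('m, real^'n) chart set \<Rightarrow> ('m, 'n) spoint \<Rightarrow> ('m, 'n) svec set" where
  "vertical_space A X =
     {Z \<in> tangent_space (slit_atlas A) X. pushforward (slit_atlas A) A fst X Z = tv_zero}"

type_synonym ('m, 'n) psection = "('m, 'n) spoint \<Rightarrow> ('m, real^'n) tvec"

text \<open>Smooth sections of the pullback tangent bundle over an open set W of E.\<close>

definition smooth_section ::
    "('m, real^'n) chart set \<Rightarrow> ('m, 'n) spoint set \<Rightarrow> ('m, 'n) psection \<Rightarrow> bool" where
  "smooth_section A W s \<longleftrightarrow>
     (\<forall>X\<in>W. s X \<in> tangent_space A (fst X)) \<and>
     (\<forall>c\<in>A. smooth_on (snd (bundle_chart A c) ` (W \<inter> fst (bundle_chart A c)))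
                      (\<lambda>z. s (chart_inv (bundle_chart A c) z) c))"

definition liouville :: "('m, 'n) psection" where
  "liouville X = snd X"

type_synonym ('m, 'n) pmetric =
  "('m, 'n) spoint \<Rightarrow> ('m, real^'n) tvec \<Rightarrow> ('m, real^'n) tvec \<Rightarrow> real"

definition is_metric :: "('m, real^'n) chart set \<Rightarrow> ('m, 'n) pmetric \<Rightarrow> bool" where
  "is_metric A g \<longleftrightarrow>
     (\<forall>X\<in>slit_bundle A. let T = tangent_space A (fst X) in
        (\<forall>u\<in>T. \<forall>v\<in>T. g X u v = g X v u) \<and>
        (\<forall>u\<in>T. \<forall>v\<in>T. \<forall>w\<in>T. g X (tv_add u v) w = g X u w + g X v w) \<and>
        (\<forall>r. \<forall>u\<in>T. \<forall>w\<in>T. g X (tv_scale r u) w = r * g X u w) \<and>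
        (\<forall>u\<in>T. (\<forall>w\<in>T. g X u w = 0) \<longrightarrow> u = tv_zero)) \<and>
     (\<forall>W s t. openin (slit_topology A) W \<and> smooth_section A W s \<and> smooth_section A W t \<longrightarrow>
        smooth_fun (slit_atlas A) W (\<lambda>X. g X (s X) (t X)))"


section \<open>Finsler connections\<close>

text \<open>
  A Finsler connection acts on local sections: \<^term>\<open>nabla s X Z\<close> is the covariant derivative
  at X along Z of a section s that is smooth on some open neighbourhood of X.  The fourth
  condition says that it depends on the germ of s only, so that this is the Koszul connection on
  global sections together with its restrictions to open sets.
\<close>

type_synonym ('m, 'n) fconn =
  "('m, 'n) psection \<Rightarrow> ('m, 'n) spoint \<Rightarrow> ('m, 'n) svec \<Rightarrow> ('m, real^'n) tvec"

definition finsler_connection :: "('m, real^'n) chart set \<Rightarrow> ('m, 'n) fconn \<Rightarrow> bool" where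
  "finsler_connection A nabla \<longleftrightarrow>
     (\<forall>W s. openin (slit_topology A) W \<and> smooth_section A W s \<longrightarrow>
        (\<forall>X\<in>W. let TE = tangent_space (slit_atlas A) X in
          (\<forall>Z\<in>TE. nabla s X Z \<in> tangent_space A (fst X)) \<and>
          (\<forall>Z\<in>TE. \<forall>Z'\<in>TE. nabla s X (tv_add Z Z') = tv_add (nabla s X Z) (nabla s X Z')) \<and>
          (\<forall>r. \<forall>Z\<in>TE. nabla s X (tv_scale r Z) = tv_scale r (nabla s X Z)) \<and>
          (\<forall>t. smooth_section A W t \<and> (\<forall>Y\<in>W. s Y = t Y) \<longrightarrow>
             (\<forall>Z\<in>TE. nabla s X Z = nabla t X Z)) \<and>
          (\<forall>t. smooth_section A W t \<longrightarrow>
             (\<forall>Z\<in>TE. nabla (\<lambda>Y. tv_add (s Y) (t Y)) X Z = tv_add (nabla s X Z) (nabla t X Z))) \<and>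
          (\<forall>f. smooth_fun (slit_atlas A) W f \<longrightarrow>
             (\<forall>Z\<in>TE. nabla (\<lambda>Y. tv_scale (f Y) (s Y)) X Z =
                tv_add (tv_scale (differential (slit_atlas A) f X Z) (s X))
                       (tv_scale (f X) (nabla s X Z))))) \<and>
        (\<forall>Z. smooth_vector_field (slit_atlas A) W Z \<longrightarrow>
          smooth_section A W (\<lambda>X. nabla s X (Z X))))"

text \<open>Equality of connections ignores the values off the intended domain.\<close>

definition same_connection ::
    "('m, real^'n) chart set \<Rightarrow> ('m, 'n) fconn \<Rightarrow> ('m, 'n) fconn \<Rightarrow> bool" where
  "same_connection A nabla nabla' \<longleftrightarrow>
     (\<forall>W s. openin (slit_topology A) W \<and> smooth_section A W s \<longrightarrow>
        (\<forall>X\<in>W. \<forall>Z\<in>tangent_space (slit_atlas A) X. nabla s X Z = nabla' s X Z))"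

definition regular_connection :: "('m, real^'n) chart set \<Rightarrow> ('m, 'n) fconn \<Rightarrow> bool" where
  "regular_connection A nabla \<longleftrightarrow>
     (\<forall>X\<in>slit_bundle A. inj_on (\<lambda>Z. nabla liouville X Z) (vertical_space A X))"


section \<open>Differential forms in coordinates\<close>

text \<open>1-forms and 2-forms on an open subset of a Euclidean space.\<close>

type_synonym 'e form1 = "'e \<Rightarrow> 'e \<Rightarrow> real"
type_synonym 'e form2 = "'e \<Rightarrow> 'e \<Rightarrow> 'e \<Rightarrow> real"

definition wedge :: "'e form1 \<Rightarrow> 'e form1 \<Rightarrow> 'e form2" where
  "wedge \<alpha> \<beta> z u v = \<alpha> z u * \<beta> z v - \<alpha> z v * \<beta> z u"

definition extd0 :: "('e::euclidean_space \<Rightarrow> real) \<Rightarrow> 'e form1" where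
  "extd0 f z u = frechet_derivative f (at z) u"

definition extd1 :: "'e::euclidean_space form1 \<Rightarrow> 'e form2" where
  "extd1 \<beta> z u v =
     frechet_derivative (\<lambda>w. \<beta> w v) (at z) u - frechet_derivative (\<lambda>w. \<beta> w u) (at z) v"

text \<open>
  Components of the covariant exterior differential, for connection 1-forms
  \<^term>\<open>\<omega> a b\<close> (upper index a, lower index b), of vector-valued 0-forms and 1-forms, and of
  (0,2)-tensor-valued 0-forms and 1-forms.
\<close>

definition D_vec0 ::
    "('n::finite \<Rightarrow> 'n \<Rightarrow> 'e::euclidean_space form1) \<Rightarrow> ('n \<Rightarrow> 'e \<Rightarrow> real) \<Rightarrow> 'n \<Rightarrow> 'e form1" where
  "D_vec0 \<omega> Y a z u = extd0 (Y a) z u + (\<Sum>b\<in>UNIV. \<omega> a b z u * Y b z)"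

definition D_vec1 ::
    "('n::finite \<Rightarrow> 'n \<Rightarrow> 'e::euclidean_space form1) \<Rightarrow> ('n \<Rightarrow> 'e form1) \<Rightarrow> 'n \<Rightarrow> 'e form2" where
  "D_vec1 \<omega> \<theta> a z u v = extd1 (\<theta> a) z u v + (\<Sum>b\<in>UNIV. wedge (\<omega> a b) (\<theta> b) z u v)"

definition D_cov0 ::
    "('n::finite \<Rightarrow> 'n \<Rightarrow> 'e::euclidean_space form1) \<Rightarrow> ('n \<Rightarrow> 'n \<Rightarrow> 'e \<Rightarrow> real) \<Rightarrow>
     'n \<Rightarrow> 'n \<Rightarrow> 'e form1" where
  "D_cov0 \<omega> S a b z u =
     extd0 (S a b) z u - (\<Sum>c\<in>UNIV. \<omega> c a z u * S c b z) - (\<Sum>c\<in>UNIV. \<omega> c b z u * S a c z)"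

definition D_cov1 ::
    "('n::finite \<Rightarrow> 'n \<Rightarrow> 'e::euclidean_space form1) \<Rightarrow> ('n \<Rightarrow> 'n \<Rightarrow> 'e form1) \<Rightarrow>
     'n \<Rightarrow> 'n \<Rightarrow> 'e form2" where
  "D_cov1 \<omega> \<theta> a b z u v =
     extd1 (\<theta> a b) z u v - (\<Sum>c\<in>UNIV. wedge (\<omega> c a) (\<theta> c b) z u v)
                         - (\<Sum>c\<in>UNIV. wedge (\<omega> c b) (\<theta> a c) z u v)"


section \<open>Components of metrics and connections in the induced coordinates of E\<close>

definition coord_domain ::
    "('m, real^'n) chart set \<Rightarrow> ('m, real^'n) chart \<Rightarrow> ((real^'n) \<times> (real^'n)) set" where
  "coord_domain A c = snd (bundle_chart A c) ` fst (bundle_chart A c)"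

definition in_coords ::
    "('m, real^'n) chart set \<Rightarrow> ('m, real^'n) chart \<Rightarrow> (('m, 'n) spoint \<Rightarrow> real) \<Rightarrow>
     (real^'n) \<times> (real^'n) \<Rightarrow> real" where
  "in_coords A c f z = f (chart_inv (bundle_chart A c) z)"

definition frame ::
    "('m, real^'n) chart set \<Rightarrow> ('m, real^'n) chart \<Rightarrow> 'n \<Rightarrow> ('m, 'n) psection" where
  "frame A c a X = tangent_of A c (fst X) (axis a 1)"

definition metric_comp ::
    "('m, real^'n) chart set \<Rightarrow> ('m, 'n) pmetric \<Rightarrow> ('m, real^'n) chart \<Rightarrow> 'n \<Rightarrow> 'n \<Rightarrow>
     (real^'n) \<times> (real^'n) \<Rightarrow> real" where
  "metric_comp A g c a b = in_coords A c (\<lambda>X. g X (frame A c a X) (frame A c b X))"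

text \<open>The connection 1-forms: the covariant derivative of the frame section with index b has
  component \<^term>\<open>conn_form A nabla c a b\<close> along the frame section with index a.\<close>

definition conn_form ::
    "('m, real^'n) chart set \<Rightarrow> ('m, 'n) fconn \<Rightarrow> ('m, real^'n) chart \<Rightarrow> 'n \<Rightarrow> 'n \<Rightarrow>
     ((real^'n) \<times> (real^'n)) form1" where
  "conn_form A nabla c a b z u =
     (let X = chart_inv (bundle_chart A c) z
      in nabla (frame A c b) X (tangent_of (slit_atlas A) (bundle_chart A c) X u) c $ a)"

definition dx :: "'n \<Rightarrow> ((real^'n) \<times> (real^'n)) form1" where
  "dx a z u = fst u $ a"

definition y_coord :: "'n \<Rightarrow> (real^'n) \<times> (real^'n) \<Rightarrow> real" where
  "y_coord a z = snd z $ a"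

definition Dy ::
    "('m, real^'n) chart set \<Rightarrow> ('m, 'n) fconn \<Rightarrow> ('m, real^'n) chart \<Rightarrow> 'n \<Rightarrow>
     ((real^'n) \<times> (real^'n)) form1" where
  "Dy A nabla c = D_vec0 (conn_form A nabla c) y_coord"

definition torsion ::
    "('m, real^'n) chart set \<Rightarrow> ('m, 'n) fconn \<Rightarrow> ('m, real^'n) chart \<Rightarrow> 'n \<Rightarrow>
     ((real^'n) \<times> (real^'n)) form2" where
  "torsion A nabla c = D_vec1 (conn_form A nabla c) dx"

definition Dg ::
    "('m, real^'n) chart set \<Rightarrow> ('m, 'n) pmetric \<Rightarrow> ('m, 'n) fconn \<Rightarrow> ('m, real^'n) chart \<Rightarrow>
     'n \<Rightarrow> 'n \<Rightarrow> ((real^'n) \<times> (real^'n)) form1" where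
  "Dg A g nabla c = D_cov0 (conn_form A nabla c) (metric_comp A g c)"

definition D2g ::
    "('m, real^'n) chart set \<Rightarrow> ('m, 'n) pmetric \<Rightarrow> ('m, 'n) fconn \<Rightarrow> ('m, real^'n) chart \<Rightarrow>
     'n \<Rightarrow> 'n \<Rightarrow> ((real^'n) \<times> (real^'n)) form2" where
  "D2g A g nabla c = D_cov1 (conn_form A nabla c) (Dg A g nabla c)"

definition torsion_free :: "('m, real^'n) chart set \<Rightarrow> ('m, 'n) fconn \<Rightarrow> bool" where
  "torsion_free A nabla \<longleftrightarrow>
     (\<forall>c\<in>A. \<forall>z\<in>coord_domain A c. \<forall>a u v. torsion A nabla c a z u v = 0)"

definition pos_homogeneity ::
    "('m, real^'n) chart set \<Rightarrow> ('m, 'n) pmetric \<Rightarrow> ('m, 'n) fconn \<Rightarrow> bool" where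
  "pos_homogeneity A g nabla \<longleftrightarrow>
     (\<forall>c\<in>A. \<forall>z\<in>coord_domain A c. \<forall>b u.
        (\<Sum>a\<in>UNIV. y_coord a z * Dg A g nabla c a b z u) = 0)"

definition almost_metric_compat ::
    "('m, real^'n) chart set \<Rightarrow> ('m, 'n) pmetric \<Rightarrow> ('m, 'n) fconn \<Rightarrow> bool" where
  "almost_metric_compat A g nabla \<longleftrightarrow>
     (\<forall>c\<in>A. \<forall>z\<in>coord_domain A c. \<forall>a u v.
        (\<Sum>b\<in>UNIV. wedge (Dg A g nabla c a b) (Dy A nabla c b) z u v) = 0)"

definition y_D2g_zero ::
    "('m, real^'n) chart set \<Rightarrow> ('m, 'n) pmetric \<Rightarrow> ('m, 'n) fconn \<Rightarrow> bool" where
  "y_D2g_zero A g nabla \<longleftrightarrow>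
     (\<forall>c\<in>A. \<forall>z\<in>coord_domain A c. \<forall>b u v.
        (\<Sum>a\<in>UNIV. y_coord a z * D2g A g nabla c a b z u v) = 0)"


section \<open>Homogeneous Lagrangians and the Chern connection\<close>

definition pos_homogeneous2 ::
    "('m, real^'n) chart set \<Rightarrow> (('m, 'n) spoint \<Rightarrow> real) \<Rightarrow> bool" where
  "pos_homogeneous2 A L \<longleftrightarrow>
     (\<forall>X\<in>slit_bundle A. \<forall>s>0. L (fst X, tv_scale s (snd X)) = s\<^sup>2 * L X)"

definition pdx ::
    "'n \<Rightarrow> ((real^'n) \<times> (real^'n) \<Rightarrow> real) \<Rightarrow> (real^'n) \<times> (real^'n) \<Rightarrow> real" where
  "pdx a f z = frechet_derivative f (at z) (axis a 1, 0)"

definition pdy ::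
    "'n \<Rightarrow> ((real^'n) \<times> (real^'n) \<Rightarrow> real) \<Rightarrow> (real^'n) \<times> (real^'n) \<Rightarrow> real" where
  "pdy a f z = frechet_derivative f (at z) (0, axis a 1)"

text \<open>In the following definitions l is a Lagrangian written in the coordinates (x, y).\<close>

definition vhess ::
    "((real^'n) \<times> (real^'n) \<Rightarrow> real) \<Rightarrow> 'n \<Rightarrow> 'n \<Rightarrow> (real^'n) \<times> (real^'n) \<Rightarrow> real" where
  "vhess l a b = pdy a (pdy b l)"

definition vhess_inv ::
    "((real^'n) \<times> (real^'n) \<Rightarrow> real) \<Rightarrow> 'n \<Rightarrow> 'n \<Rightarrow> (real^'n) \<times> (real^'n) \<Rightarrow> real" where
  "vhess_inv l a b z = matrix_inv (\<chi> i j. vhess l i j z) $ a $ b"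

definition spray ::
    "((real^'n) \<times> (real^'n) \<Rightarrow> real) \<Rightarrow> 'n \<Rightarrow> (real^'n) \<times> (real^'n) \<Rightarrow> real" where
  "spray l a z = (1/2) * (\<Sum>d\<in>UNIV. vhess_inv l a d z *
     ((\<Sum>c\<in>UNIV. pdx c (pdy d l) z * y_coord c z) - pdx d l z))"

definition barthel ::
    "((real^'n) \<times> (real^'n) \<Rightarrow> real) \<Rightarrow> 'n \<Rightarrow> 'n \<Rightarrow> (real^'n) \<times> (real^'n) \<Rightarrow> real" where
  "barthel l a c = pdy c (spray l a)"

definition hdelta ::
    "((real^'n) \<times> (real^'n) \<Rightarrow> real) \<Rightarrow> 'n \<Rightarrow> ((real^'n) \<times> (real^'n) \<Rightarrow> real) \<Rightarrow>
     (real^'n) \<times> (real^'n) \<Rightarrow> real" where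
  "hdelta l a f z = pdx a f z - (\<Sum>b\<in>UNIV. barthel l b a z * pdy b f z)"

definition chern_coeff ::
    "((real^'n) \<times> (real^'n) \<Rightarrow> real) \<Rightarrow> 'n \<Rightarrow> 'n \<Rightarrow> 'n \<Rightarrow> (real^'n) \<times> (real^'n) \<Rightarrow> real" where
  "chern_coeff l a b c z = (1/2) * (\<Sum>n\<in>UNIV. vhess_inv l a n z *
     (hdelta l b (vhess l n c) z + hdelta l c (vhess l n b) z - hdelta l n (vhess l b c) z))"

definition is_vertical_hessian ::
    "('m, real^'n) chart set \<Rightarrow> ('m, 'n) pmetric \<Rightarrow> (('m, 'n) spoint \<Rightarrow> real) \<Rightarrow> bool" where
  "is_vertical_hessian A g L \<longleftrightarrow>
     (\<forall>c\<in>A. \<forall>z\<in>coord_domain A c. \<forall>a b. metric_comp A g c a b z = vhess (in_coords A c L) a b z)"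

definition is_chern_connection ::
    "('m, real^'n) chart set \<Rightarrow> (('m, 'n) spoint \<Rightarrow> real) \<Rightarrow> ('m, 'n) fconn \<Rightarrow> bool" where
  "is_chern_connection A L nabla \<longleftrightarrow>
     (\<forall>c\<in>A. \<forall>z\<in>coord_domain A c. \<forall>a b u.
        conn_form A nabla c a b z u =
          (\<Sum>d\<in>UNIV. chern_coeff (in_coords A c L) a b d z * dx d z u))"

end

theory Submission
  imports Defs
begin

text \<open>
  Evaluating T = 0 on a vertical and a horizontal vector shows that the connection forms are
  horizontal, with coefficients H symmetric in the lower indices.  Put L = g(y, y)/2.  The vertical
  part of the homogeneity condition gives first \<open>\<partial>L/\<partial>y\<^sup>c = g\<^sub>c\<^sub>b y\<^sup>b\<close> and then that g is the vertical Hessian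
  of L, and Euler's identity for L integrates along rays to homogeneity of degree 2.  Almost metric
  compatibility says that Dg vanishes on the vectors annihilated by Dy, so the Koszul formula
  expresses H through g and the non-linear connection \<open>N\<^sup>a\<^sub>c = H\<^sup>a\<^sub>b\<^sub>c y\<^sup>b\<close>; contracting it twice with y
  gives \<open>N\<^sup>a\<^sub>c y\<^sup>c = 2G\<^sup>a\<close>, and comparing the simple contraction with the vertical derivative of \<open>G\<^sup>a\<close> identifies
  N with the Barthel connection.  Hence H is the Chern coefficient and is determined by g.
  The alternative condition reduces to the first one by applying D to \<open>y\<^sup>a Dg\<^sub>a\<^sub>b = 0\<close>.
\<close>

section \<open>Calculus of smooth maps\<close>

text \<open>The Koszul formula is circular here: the horizontal derivative that it uses contains N,
  and N is itself a contraction of H. Two facts break the circle. Since y^a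
  \<partial>g_ab/\<partial>y^c = 0, contracting a metric index with y removes the N term; the double
  contraction is therefore free of N and gives N^a_c y^c in terms of g alone. In the single
  contraction N survives only in the term whose derivative index is contracted, and only as N^e_b
  y^b, which is known by then. As \<partial>g_ab/\<partial>y^c is symmetric in all its indices, this
  residue equals the product-rule term in the vertical derivative of g_ne G^e, and the comparison
  with the Barthel connection closes.

  Derivatives of L are always rewritten through g, so the local argument differentiates only g, y
  and the spray. It is carried out for functions on an open set of coordinates; the bundle part
  supplies the hypotheses chart by chart. Since L is defined without coordinates, the local results
  concern one and the same function.\<close>

lemma Ck_on_Suc_differentiable:
  assumes "Ck_on (Suc k) S f" "open S" "x \<in> S"
  shows "f differentiable (at x)"
  using assms by (metis Ck_on.simps(2) at_within_open differentiable_on_def)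

lemma Ck_on_cong:
  assumes "open S" "\<And>x. x \<in> S \<Longrightarrow> f x = g x"
  shows "Ck_on k S f \<longleftrightarrow> Ck_on k S g"
proof -
  have "Ck_on k S g" if "Ck_on k S f" "\<And>x. x \<in> S \<Longrightarrow> f x = g x" for f g :: "'a \<Rightarrow> 'b"
    using that
  proof (induction k arbitrary: f g)
    case 0
    then show ?case using continuous_on_cong[of S S f g] by simp
  next
    case (Suc k)
    have d: "(g has_derivative frechet_derivative f (at x)) (at x)" if "x \<in> S" for x
    proof (rule has_derivative_transform_within_open[OF _ \<open>open S\<close> that])
      show "(f has_derivative frechet_derivative f (at x)) (at x)"
        using Ck_on_Suc_differentiable[OF Suc.prems(1) \<open>open S\<close> that]
        by (simp add: frechet_derivative_works)
    qed (use Suc.prems in simp)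
    have "g differentiable_on S"
      using d by (meson differentiableI differentiable_at_withinI differentiable_on_def)
    moreover have "Ck_on k S (\<lambda>x. frechet_derivative g (at x) v)" for v
      by (rule Suc.IH[of "\<lambda>x. frechet_derivative f (at x) v"])
         (use Suc.prems(1) in \<open>simp_all add: frechet_derivative_at[OF d, symmetric]\<close>)
    ultimately show ?case by simp
  qed
  from this[of f g] this[of g f] assms(2) show ?thesis by auto
qed

lemma Ck_on_subset:
  assumes "Ck_on k S f" "T \<subseteq> S"
  shows "Ck_on k T f"
  using assms
  by (induction k arbitrary: f) (auto intro: continuous_on_subset differentiable_on_subset)

lemma Ck_on_SucD:
  assumes "Ck_on (Suc k) S f"
  shows "Ck_on k S f"
  using assms
proof (induction k arbitrary: f)
  case 0
  then show ?case by (auto simp: differentiable_imp_continuous_on)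
next
  case (Suc k)
  then show ?case by (metis Ck_on.simps(2))
qed

lemma Ck_on_const: "Ck_on k S (\<lambda>x. c)"
  by (induction k arbitrary: c) auto

lemma Ck_on_bounded_linear:
  assumes "bounded_linear f"
  shows "Ck_on k S f"
proof (cases k)
  case 0
  then show ?thesis using assms by (simp add: linear_continuous_on)
next
  case (Suc j)
  have "frechet_derivative f (at x) = f" for x
    using frechet_derivative_at[OF bounded_linear_imp_has_derivative[OF assms]] by simp
  then show ?thesis
    using Suc assms by (simp add: Ck_on_const bounded_linear_imp_differentiable_on)
qed

lemma Ck_on_add:
  assumes "open S" "Ck_on k S f" "Ck_on k S g"
  shows "Ck_on k S (\<lambda>x. f x + g x)"
  using assms(2,3)
proof (induction k arbitrary: f g)
  case 0
  then show ?case by (simp add: continuous_on_add)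
next
  case (Suc k)
  have "(\<lambda>x. f x + g x) differentiable_on S"
    using Suc.prems by (simp add: differentiable_on_add)
  moreover have "Ck_on k S (\<lambda>x. frechet_derivative (\<lambda>x. f x + g x) (at x) v)" for v
  proof -
    have "frechet_derivative (\<lambda>x. f x + g x) (at x) v
          = frechet_derivative f (at x) v + frechet_derivative g (at x) v" if "x \<in> S" for x
    proof -
      have "f differentiable at x" "g differentiable at x"
        using Suc.prems that \<open>open S\<close> by (blast intro: Ck_on_Suc_differentiable)+
      then have "((\<lambda>x. f x + g x) has_derivative
          (\<lambda>v. frechet_derivative f (at x) v + frechet_derivative g (at x) v)) (at x)"
        by (intro has_derivative_add) (auto simp: frechet_derivative_works[symmetric])
      from frechet_derivative_at[OF this, symmetric] show ?thesis by simp
    qed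
    then have "Ck_on k S (\<lambda>x. frechet_derivative (\<lambda>x. f x + g x) (at x) v) \<longleftrightarrow>
      Ck_on k S (\<lambda>x. frechet_derivative f (at x) v + frechet_derivative g (at x) v)"
      by (intro Ck_on_cong) (auto simp: assms)
    then show ?thesis using Suc by auto
  qed
  ultimately show ?case by simp
qed

text \<open>The product rule turns the derivative into two products, each with one factor left
  undifferentiated and thus still of class C^k by \<open>Ck_on_SucD\<close>. The bilinear form
  covers scalar multiples, products and inner products at once.\<close>

lemma Ck_on_bilinear:
  assumes "bounded_bilinear pr" "open S" "Ck_on k S f" "Ck_on k S g"
  shows "Ck_on k S (\<lambda>x. pr (f x) (g x))"
  using assms(3,4)
proof (induction k arbitrary: f g)
  case 0
  then show ?case by (simp add: bounded_bilinear.continuous_on[OF assms(1)])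
next
  case (Suc k)
  have d: "((\<lambda>x. pr (f x) (g x)) has_derivative
          (\<lambda>v. pr (f x) (frechet_derivative g (at x) v) + pr (frechet_derivative f (at x) v) (g x)))
          (at x)" if "x \<in> S" for x
  proof -
    have "f differentiable at x" "g differentiable at x"
      using Suc.prems that \<open>open S\<close> by (blast intro: Ck_on_Suc_differentiable)+
    then show ?thesis
      by (intro bounded_bilinear.FDERIV[OF assms(1)]) (auto simp: frechet_derivative_works[symmetric])
  qed
  have "(\<lambda>x. pr (f x) (g x)) differentiable_on S"
    using d by (meson differentiableI differentiable_at_withinI differentiable_on_def)
  moreover have "Ck_on k S (\<lambda>x. frechet_derivative (\<lambda>x. pr (f x) (g x)) (at x) v)" for v
  proof -
    have "Ck_on k S (\<lambda>x. frechet_derivative (\<lambda>x. pr (f x) (g x)) (at x) v) \<longleftrightarrow>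
      Ck_on k S (\<lambda>x. pr (f x) (frechet_derivative g (at x) v)
                      + pr (frechet_derivative f (at x) v) (g x))"
      by (intro Ck_on_cong assms) (simp add: frechet_derivative_at[OF d, symmetric])
    moreover have "Ck_on k S f" "Ck_on k S g" using Suc.prems Ck_on_SucD by blast+
    ultimately show ?thesis using Suc by (auto intro!: Ck_on_add assms)
  qed
  ultimately show ?case by simp
qed

lemma Ck_on_sum:
  assumes "open S" "\<And>i. i \<in> I \<Longrightarrow> Ck_on k S (f i)"
  shows "Ck_on k S (\<lambda>x. \<Sum>i\<in>I. f i x)"
  using assms(2)
  by (induction I rule: infinite_finite_induct) (auto intro: Ck_on_const Ck_on_add assms(1))

lemma linear_euclidean_expansion:
  fixes L :: "'a::euclidean_space \<Rightarrow> 'b::real_vector"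
  assumes "linear L"
  shows "L u = (\<Sum>i\<in>Basis. (u \<bullet> i) *\<^sub>R L i)"
proof -
  have "L u = L (\<Sum>i\<in>Basis. (u \<bullet> i) *\<^sub>R i)" by (simp add: euclidean_representation)
  also have "\<dots> = (\<Sum>i\<in>Basis. (u \<bullet> i) *\<^sub>R L i)"
    using assms by (simp add: linear_sum linear_cmul)
  finally show ?thesis .
qed

text \<open>The chain rule yields the derivative of \<open>g\<close> at \<open>f x\<close> in a
  direction that varies with x, whereas \<open>Ck_on\<close> speaks of fixed directions. Expanding
  the direction in \<open>Basis\<close> leaves scalar coefficients times compositions of
  \<open>f\<close> with fixed directional derivatives of \<open>g\<close>, to which the induction
  hypothesis applies.\<close>

lemma Ck_on_compose:
  fixes f :: "'a::euclidean_space \<Rightarrow> 'b::euclidean_space"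
  assumes "open S" "open T" "f ` S \<subseteq> T" "Ck_on k S f" "Ck_on k T g"
  shows "Ck_on k S (\<lambda>x. g (f x))"
  using assms(4,5)
proof (induction k arbitrary: g)
  case 0
  then show ?case using assms continuous_on_compose2 by (metis Ck_on.simps(1))
next
  case (Suc k)
  have df: "f differentiable at x" if "x \<in> S" for x
    using Suc.prems that \<open>open S\<close> by (blast intro: Ck_on_Suc_differentiable)
  have dg: "g differentiable at x" if "x \<in> T" for x
    using Suc.prems that \<open>open T\<close> by (blast intro: Ck_on_Suc_differentiable)
  have d: "((\<lambda>x. g (f x)) has_derivative
      (\<lambda>v. frechet_derivative g (at (f x)) (frechet_derivative f (at x) v))) (at x)" if "x \<in> S" for x
  proof -
    have "f x \<in> T" using that assms by auto
    then show ?thesis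
      using diff_chain_at[of f "frechet_derivative f (at x)" x g "frechet_derivative g (at (f x))"]
        df[OF that] dg by (auto simp: frechet_derivative_works[symmetric] o_def)
  qed
  have "(\<lambda>x. g (f x)) differentiable_on S"
    using d by (meson differentiableI differentiable_at_withinI differentiable_on_def)
  moreover have "Ck_on k S (\<lambda>x. frechet_derivative (\<lambda>x. g (f x)) (at x) v)" for v
  proof -
    have eq: "frechet_derivative (\<lambda>x. g (f x)) (at x) v
        = (\<Sum>i\<in>Basis. (frechet_derivative f (at x) v \<bullet> i) *\<^sub>R frechet_derivative g (at (f x)) i)"
      if "x \<in> S" for x
    proof -
      have "f x \<in> T" using that assms by auto
      have "frechet_derivative (\<lambda>x. g (f x)) (at x) v
          = frechet_derivative g (at (f x)) (frechet_derivative f (at x) v)"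
        by (simp add: frechet_derivative_at[OF d[OF that], symmetric])
      also have "\<dots> = (\<Sum>i\<in>Basis. (frechet_derivative f (at x) v \<bullet> i) *\<^sub>R frechet_derivative g (at (f x)) i)"
        by (rule linear_euclidean_expansion)
           (simp add: dg[OF \<open>f x \<in> T\<close>] linear_frechet_derivative)
      finally show ?thesis .
    qed
    have "Ck_on k S f" using Suc.prems Ck_on_SucD by blast
    have "Ck_on k S (\<lambda>x. frechet_derivative f (at x) v \<bullet> i)" for i
      using Suc.prems by (intro Ck_on_bilinear[OF bounded_bilinear_inner] Ck_on_const \<open>open S\<close>) auto
    moreover have "Ck_on k S (\<lambda>x. frechet_derivative g (at (f x)) i)" for i
      using Suc.prems \<open>Ck_on k S f\<close> by (intro Suc.IH) auto
    ultimately have "Ck_on k S (\<lambda>x. \<Sum>i\<in>Basis. (frechet_derivative f (at x) v \<bullet> i) *\<^sub>R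
        frechet_derivative g (at (f x)) i)"
      by (intro Ck_on_sum Ck_on_bilinear[OF bounded_bilinear_scaleR] \<open>open S\<close>)
    then show ?thesis by (subst Ck_on_cong[OF \<open>open S\<close> eq])
  qed
  ultimately show ?case by simp
qed

section \<open>Closure properties of smooth maps\<close>

lemma smooth_on_cong:
  assumes "open S" "\<And>x. x \<in> S \<Longrightarrow> f x = g x"
  shows "smooth_on S f \<longleftrightarrow> smooth_on S g"
  using Ck_on_cong[OF assms] by (simp add: smooth_on_def)

lemma smooth_on_subset: "smooth_on S f \<Longrightarrow> T \<subseteq> S \<Longrightarrow> smooth_on T f"
  by (auto simp: smooth_on_def intro: Ck_on_subset)

lemma smooth_on_const: "smooth_on S (\<lambda>x. c)"
  by (simp add: smooth_on_def Ck_on_const)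

lemma smooth_on_bounded_linear: "bounded_linear f \<Longrightarrow> smooth_on S f"
  by (simp add: smooth_on_def Ck_on_bounded_linear)

lemma smooth_on_add:
  "open S \<Longrightarrow> smooth_on S f \<Longrightarrow> smooth_on S g \<Longrightarrow> smooth_on S (\<lambda>x. f x + g x)"
  by (simp add: smooth_on_def Ck_on_add)

lemma smooth_on_bilinear:
  "bounded_bilinear pr \<Longrightarrow> open S \<Longrightarrow> smooth_on S f \<Longrightarrow> smooth_on S g \<Longrightarrow>
    smooth_on S (\<lambda>x. pr (f x) (g x))"
  by (simp add: smooth_on_def Ck_on_bilinear)

lemmas smooth_on_scaleR = smooth_on_bilinear[OF bounded_bilinear_scaleR]
lemmas smooth_on_mult = smooth_on_bilinear[OF bounded_bilinear_mult]
lemmas smooth_on_inner = smooth_on_bilinear[OF bounded_bilinear_inner]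

lemma smooth_on_sum:
  "open S \<Longrightarrow> (\<And>i. i \<in> I \<Longrightarrow> smooth_on S (f i)) \<Longrightarrow> smooth_on S (\<lambda>x. \<Sum>i\<in>I. f i x)"
  by (simp add: smooth_on_def Ck_on_sum)

lemma smooth_on_compose:
  fixes f :: "'a::euclidean_space \<Rightarrow> 'b::euclidean_space"
  shows "open S \<Longrightarrow> open T \<Longrightarrow> f ` S \<subseteq> T \<Longrightarrow> smooth_on S f \<Longrightarrow> smooth_on T g \<Longrightarrow>
    smooth_on S (\<lambda>x. g (f x))"
  unfolding smooth_on_def using Ck_on_compose by blast

lemma smooth_on_linear_compose:
  fixes f :: "'a::euclidean_space \<Rightarrow> 'b::euclidean_space"
  assumes "bounded_linear L" "open S" "smooth_on S f"
  shows "smooth_on S (\<lambda>x. L (f x))"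
  by (rule smooth_on_compose[OF assms(2) open_UNIV _ assms(3)])
     (auto intro: smooth_on_bounded_linear assms)

lemma smooth_on_Pair:
  fixes f :: "'a::euclidean_space \<Rightarrow> 'b::euclidean_space" and g :: "'a \<Rightarrow> 'c::euclidean_space"
  assumes "open S" "smooth_on S f" "smooth_on S g"
  shows "smooth_on S (\<lambda>x. (f x, g x))"
proof -
  have "smooth_on S (\<lambda>x. (f x, 0) + (0, g x))"
    using assms by (intro smooth_on_add smooth_on_linear_compose[where L = "\<lambda>u. (u, 0)"]
        smooth_on_linear_compose[where L = "\<lambda>u. (0, u)"])
      (auto intro: bounded_linear_Pair bounded_linear_ident bounded_linear_zero)
  then show ?thesis by simp
qed

lemma smooth_on_derivative: "smooth_on S f \<Longrightarrow> smooth_on S (\<lambda>x. frechet_derivative f (at x) v)"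
  unfolding smooth_on_def by (metis Ck_on.simps(2))

lemma smooth_on_differentiable: "smooth_on S f \<Longrightarrow> open S \<Longrightarrow> x \<in> S \<Longrightarrow> f differentiable (at x)"
  unfolding smooth_on_def by (metis Ck_on.simps(2) at_within_open differentiable_on_def)

lemma smooth_on_has_derivative:
  "smooth_on S f \<Longrightarrow> open S \<Longrightarrow> x \<in> S \<Longrightarrow> (f has_derivative frechet_derivative f (at x)) (at x)"
  by (metis smooth_on_differentiable frechet_derivative_works)

text \<open>Meant for Jacobians of transition maps acting on components, where the base point and
  the argument both vary.\<close>

lemma smooth_on_derivative_compose:
  fixes h :: "'a::euclidean_space \<Rightarrow> 'b::euclidean_space" and f :: "'b \<Rightarrow> 'c::real_normed_vector"
  assumes "open S" "open T" "h ` S \<subseteq> T" "smooth_on S h" "smooth_on T f" "smooth_on S k"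
  shows "smooth_on S (\<lambda>x. frechet_derivative f (at (h x)) (k x))"
proof -
  have "smooth_on S (\<lambda>x. \<Sum>i\<in>Basis. (k x \<bullet> i) *\<^sub>R frechet_derivative f (at (h x)) i)"
    using assms
    by (intro smooth_on_sum smooth_on_scaleR smooth_on_inner smooth_on_const
        smooth_on_compose[where f = h and g = "\<lambda>y. frechet_derivative f (at y) i" for i]
        smooth_on_derivative)
  moreover have "frechet_derivative f (at (h x)) (k x) =
      (\<Sum>i\<in>Basis. (k x \<bullet> i) *\<^sub>R frechet_derivative f (at (h x)) i)" if "x \<in> S" for x
    by (rule linear_euclidean_expansion, rule linear_frechet_derivative)
       (use that assms smooth_on_differentiable in blast)
  ultimately show ?thesis using smooth_on_cong[OF \<open>open S\<close>] by (metis (no_types, lifting))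
qed

section \<open>Symmetry of second derivatives\<close>

text \<open>Both iterated derivatives are the limit of the second difference quotient
  (f (z + t u + t v) - f (z + t u) - f (z + t v) + f z) / t^2.\<close>

lemma second_difference_bound:
  fixes f :: "'a::euclidean_space \<Rightarrow> real"
  assumes S: "open S" "z \<in> S" and f: "f differentiable_on S"
    and F: "(\<lambda>x. frechet_derivative f (at x) u) differentiable (at z)" and "e > 0"
  shows "eventually (\<lambda>t. \<bar>f (z + t *\<^sub>R u + t *\<^sub>R v) - f (z + t *\<^sub>R u) - f (z + t *\<^sub>R v) + f z
      - t\<^sup>2 * frechet_derivative (\<lambda>x. frechet_derivative f (at x) u) (at z) v\<bar> \<le> e * t\<^sup>2) (at_right 0)"
proof -
  have f: "f differentiable (at x)" if "x \<in> S" for x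
    using f S that by (metis at_within_open differentiable_on_def)
  define F where "F x = frechet_derivative f (at x) u" for x
  define F' where "F' = frechet_derivative F (at z)"
  \<comment> \<open>An increment s u + s' v with 0 \<le> s, s' \<le> t has norm at most t K; the
    summand 1 keeps K positive when u and v both vanish.\<close>
  define K where "K = norm u + norm v + 1"
  have "K > 0" unfolding K_def by (simp add: add_nonneg_pos)
  \<comment> \<open>Two first-order errors of size e' t K each will add up to e t.\<close>
  define e' where "e' = e / (2 * K)"
  have "e' > 0" using \<open>e > 0\<close> \<open>K > 0\<close> by (simp add: e'_def)
  have "(F has_derivative F') (at z)"
    using F by (simp add: F_def[abs_def] F'_def frechet_derivative_works[symmetric])
  then have linF': "linear F'" and "\<exists>d>0. \<forall>w. norm (w - z) < d \<longrightarrow>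
      norm (F w - F z - F' (w - z)) \<le> e' * norm (w - z)"
    using \<open>e' > 0\<close> by (auto simp: has_derivative_at_alt bounded_linear.linear)
  then obtain d where d: "d > 0" "\<And>w. norm (w - z) < d \<Longrightarrow> norm (F w - F z - F' (w - z)) \<le> e' * norm (w - z)"
    by blast
  obtain r where r: "r > 0" "ball z r \<subseteq> S" using S by (meson open_contains_ball)
  define t0 where "t0 = min d r / K"
  have "t0 > 0" using d r \<open>K > 0\<close> by (simp add: t0_def)
  have main: "\<bar>f (z + t *\<^sub>R u + t *\<^sub>R v) - f (z + t *\<^sub>R u) - f (z + t *\<^sub>R v) + f z
      - t\<^sup>2 * F' v\<bar> \<le> e * t\<^sup>2" if t: "0 < t" "t < t0" for t
  proof -
    have tK: "t * K < min d r" using t \<open>K > 0\<close> by (simp add: t0_def field_simps)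
    have small: "norm (s *\<^sub>R u + s' *\<^sub>R v) \<le> t * K" if "0 \<le> s" "s \<le> t" "0 \<le> s'" "s' \<le> t" for s s'
    proof -
      have "norm (s *\<^sub>R u + s' *\<^sub>R v) \<le> s * norm u + s' * norm v"
        using norm_triangle_ineq[of "s *\<^sub>R u" "s' *\<^sub>R v"] that by simp
      also have "\<dots> \<le> t * norm u + t * norm v" using that by (intro add_mono mult_right_mono) auto
      also have "\<dots> \<le> t * K" using t by (simp add: K_def algebra_simps)
      finally show ?thesis .
    qed
    have inS: "z + s *\<^sub>R u + s' *\<^sub>R v \<in> S" if "0 \<le> s" "s \<le> t" "0 \<le> s'" "s' \<le> t" for s s'
    proof -
      have "dist z (z + s *\<^sub>R u + s' *\<^sub>R v) < r"
        using small[OF that] tK norm_minus_cancel[of "s *\<^sub>R u + s' *\<^sub>R v"]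
        by (simp add: dist_norm add.assoc del: norm_minus_cancel)
      then show ?thesis using r by auto
    qed
    \<comment> \<open>Differencing along v first makes the second difference an increment of \<phi>
      along u. One mean value step then suffices, and \<open>F\<close> has to be differentiable at z
      only.\<close>
    define \<phi> where "\<phi> s = f (z + s *\<^sub>R u + t *\<^sub>R v) - f (z + s *\<^sub>R u)" for s
    have der: "(\<phi> has_real_derivative F (z + s *\<^sub>R u + t *\<^sub>R v) - F (z + s *\<^sub>R u)) (at s)"
      if "0 \<le> s" "s \<le> t" for s
    proof -
      have 1: "((\<lambda>s. f (z + s *\<^sub>R u + c)) has_real_derivative F (z + s *\<^sub>R u + c)) (at s)"
        if "z + s *\<^sub>R u + c \<in> S" for c
      proof -
        have "((\<lambda>s. z + s *\<^sub>R u + c) has_derivative (\<lambda>h. h *\<^sub>R u)) (at s)"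
          by (auto intro!: derivative_eq_intros)
        from diff_chain_at[OF this f[OF that, unfolded frechet_derivative_works]]
        have "((\<lambda>s. f (z + s *\<^sub>R u + c)) has_derivative
            (\<lambda>h. frechet_derivative f (at (z + s *\<^sub>R u + c)) (h *\<^sub>R u))) (at s)"
          by (simp add: o_def)
        moreover have "frechet_derivative f (at (z + s *\<^sub>R u + c)) (h *\<^sub>R u) = F (z + s *\<^sub>R u + c) * h" for h
          using linear_frechet_derivative[OF f[OF that]] by (simp add: F_def linear_cmul)
        ultimately show ?thesis by (simp add: has_field_derivative_def)
      qed
      show ?thesis unfolding \<phi>_def
        using 1[of "t *\<^sub>R v"] 1[of 0] inS[of s t] inS[of s 0] that t
        by (intro DERIV_diff) auto
    qed
    obtain \<xi> where \<xi>: "0 < \<xi>" "\<xi> < t"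
      "\<phi> t - \<phi> 0 = t * (F (z + \<xi> *\<^sub>R u + t *\<^sub>R v) - F (z + \<xi> *\<^sub>R u))"
      using MVT2[OF t(1) der] by auto
    have b1: "\<bar>F (z + \<xi> *\<^sub>R u + t *\<^sub>R v) - F z - F' (\<xi> *\<^sub>R u + t *\<^sub>R v)\<bar> \<le> e' * (t * K)"
    proof -
      have n: "norm (\<xi> *\<^sub>R u + t *\<^sub>R v) \<le> t * K" using small[of \<xi> t] \<xi> t by auto
      then have "norm (F (z + \<xi> *\<^sub>R u + t *\<^sub>R v) - F z - F' (\<xi> *\<^sub>R u + t *\<^sub>R v))
          \<le> e' * norm (\<xi> *\<^sub>R u + t *\<^sub>R v)"
        using d(2)[of "z + \<xi> *\<^sub>R u + t *\<^sub>R v"] tK by (simp add: add.assoc)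
      also have "\<dots> \<le> e' * (t * K)" using n \<open>e' > 0\<close> by simp
      finally show ?thesis by simp
    qed
    have b2: "\<bar>F (z + \<xi> *\<^sub>R u) - F z - F' (\<xi> *\<^sub>R u)\<bar> \<le> e' * (t * K)"
    proof -
      have n: "norm (\<xi> *\<^sub>R u) \<le> t * K" using small[of \<xi> 0] \<xi> t by auto
      then have "norm (F (z + \<xi> *\<^sub>R u) - F z - F' (\<xi> *\<^sub>R u)) \<le> e' * norm (\<xi> *\<^sub>R u)"
        using d(2)[of "z + \<xi> *\<^sub>R u"] tK by simp
      also have "\<dots> \<le> e' * (t * K)" using n \<open>e' > 0\<close> by (intro mult_left_mono) auto
      finally show ?thesis by simp
    qed
    have F'uv: "F' (\<xi> *\<^sub>R u + t *\<^sub>R v) = F' (\<xi> *\<^sub>R u) + t * F' v"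
      using linF' by (simp add: linear_add linear_cmul)
    have "\<bar>F (z + \<xi> *\<^sub>R u + t *\<^sub>R v) - F (z + \<xi> *\<^sub>R u) - t * F' v\<bar> \<le> 2 * (e' * (t * K))"
      using b1 b2 F'uv by linarith
    also have "\<dots> = e * t" using \<open>K > 0\<close> by (simp add: e'_def)
    finally have "t * \<bar>F (z + \<xi> *\<^sub>R u + t *\<^sub>R v) - F (z + \<xi> *\<^sub>R u) - t * F' v\<bar> \<le> t * (e * t)"
      using t by (intro mult_left_mono) auto
    moreover have "t * \<bar>F (z + \<xi> *\<^sub>R u + t *\<^sub>R v) - F (z + \<xi> *\<^sub>R u) - t * F' v\<bar>
        = \<bar>\<phi> t - \<phi> 0 - t\<^sup>2 * F' v\<bar>"
    proof -
      have "\<phi> t - \<phi> 0 - t\<^sup>2 * F' v = t * (F (z + \<xi> *\<^sub>R u + t *\<^sub>R v) - F (z + \<xi> *\<^sub>R u) - t * F' v)"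
        using \<xi>(3) by (simp add: power2_eq_square algebra_simps)
      then show ?thesis using t by (simp add: abs_mult)
    qed
    ultimately show ?thesis by (simp add: \<phi>_def power2_eq_square algebra_simps)
  qed
  show ?thesis
    unfolding eventually_at_right_field
    by (intro exI[of _ t0]) (use \<open>t0 > 0\<close> main in \<open>auto simp: F'_def F_def[abs_def]\<close>)
qed

lemma frechet_derivative_commute:
  fixes f :: "'a::euclidean_space \<Rightarrow> real"
  assumes "open S" "z \<in> S" "smooth_on S f"
  shows "frechet_derivative (\<lambda>x. frechet_derivative f (at x) u) (at z) v =
         frechet_derivative (\<lambda>x. frechet_derivative f (at x) v) (at z) u" (is "?A = ?B")
proof (rule ccontr)
  assume "?A \<noteq> ?B"
  \<comment> \<open>Each iterated derivative lies within e of the same quotient, so the gap would be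
    at most 2 e, two thirds of itself.\<close>
  define e where "e = \<bar>?A - ?B\<bar> / 3"
  have "e > 0" using \<open>?A \<noteq> ?B\<close> by (simp add: e_def)
  have dif: "f differentiable_on S"
    "\<And>w. (\<lambda>x. frechet_derivative f (at x) w) differentiable (at z)"
    using assms smooth_on_differentiable smooth_on_derivative
    by (blast intro: differentiable_at_imp_differentiable_on)+
  note 1 = second_difference_bound[OF assms(1,2) dif(1) dif(2) \<open>e > 0\<close>, of u v]
  note 2 = second_difference_bound[OF assms(1,2) dif(1) dif(2) \<open>e > 0\<close>, of v u]
  have "eventually (\<lambda>t::real. t > 0) (at_right 0)" by (simp add: eventually_at_right_less)
  with 1 2 have "eventually (\<lambda>t::real. False) (at_right 0)"
  proof eventually_elim
    case (elim t)
    \<comment> \<open>The second difference is unchanged when u and v are exchanged.\<close>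
    have "z + t *\<^sub>R v + t *\<^sub>R u = z + t *\<^sub>R u + t *\<^sub>R v" by (simp add: algebra_simps)
    with elim have "\<bar>t\<^sup>2 * ?A - t\<^sup>2 * ?B\<bar> \<le> 2 * (e * t\<^sup>2)" by (smt (verit))
    then have "t\<^sup>2 * \<bar>?A - ?B\<bar> \<le> t\<^sup>2 * (2 * e)"
      by (simp add: abs_mult flip: right_diff_distrib) (simp add: ac_simps)
    then have "\<bar>?A - ?B\<bar> \<le> 2 * e" using elim(3) by simp
    then show False using \<open>e > 0\<close> by (simp add: e_def)
  qed
  then show False by simp
qed

section \<open>The Chern connection in a chart\<close>

lemma frechet_derivative_cong:
  assumes "open S" "z \<in> S" "\<And>x. x \<in> S \<Longrightarrow> f x = g x"
  shows "frechet_derivative f (at z) = frechet_derivative g (at z)"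
proof -
  \<comment> \<open>\<open>frechet_derivative\<close> picks one of the derivatives at the point, so
    agreement of all candidates D gives equality, also where neither function is
    differentiable.\<close>
  have "(f has_derivative D) (at z) \<longleftrightarrow> (g has_derivative D) (at z)" for D
    using has_derivative_transform_within_open[OF _ assms(1,2), of f D UNIV g]
      has_derivative_transform_within_open[OF _ assms(1,2), of g D UNIV f] assms(3) by auto
  then show ?thesis by (simp add: frechet_derivative_def)
qed

lemma pdx_cong: "open S \<Longrightarrow> z \<in> S \<Longrightarrow> (\<And>x. x \<in> S \<Longrightarrow> f x = g x) \<Longrightarrow> pdx a f z = pdx a g z"
  and pdy_cong: "open S \<Longrightarrow> z \<in> S \<Longrightarrow> (\<And>x. x \<in> S \<Longrightarrow> f x = g x) \<Longrightarrow> pdy a f z = pdy a g z"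
  unfolding pdx_def pdy_def by (simp_all add: frechet_derivative_cong[of S z f g])

lemma pdx_eqI: "(f has_derivative D) (at z) \<Longrightarrow> pdx a f z = D (axis a 1, 0)"
  and pdy_eqI: "(f has_derivative D) (at z) \<Longrightarrow> pdy a f z = D (0, axis a 1)"
  unfolding pdx_def pdy_def by (simp_all add: frechet_derivative_at[symmetric])

lemma frechet_derivative_partials:
  fixes f :: "(real^'n) \<times> (real^'n) \<Rightarrow> real"
  assumes "f differentiable (at z)"
  shows "frechet_derivative f (at z) u = (\<Sum>c\<in>UNIV. fst u $ c * pdx c f z) + (\<Sum>c\<in>UNIV. snd u $ c * pdy c f z)"
proof -
  let ?D = "frechet_derivative f (at z)"
  have lin: "linear ?D" by (rule linear_frechet_derivative[OF assms])
  have "u = (\<Sum>c\<in>UNIV. (fst u $ c) *\<^sub>R (axis c 1, 0)) + (\<Sum>c\<in>UNIV. (snd u $ c) *\<^sub>R (0, axis c 1))"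
    using basis_expansion[of "fst u"] basis_expansion[of "snd u"]
    by (simp add: prod_eq_iff fst_sum snd_sum scalar_mult_eq_scaleR)
  then have "?D u = ?D ((\<Sum>c\<in>UNIV. (fst u $ c) *\<^sub>R (axis c 1, 0)) + (\<Sum>c\<in>UNIV. (snd u $ c) *\<^sub>R (0, axis c 1)))"
    by simp
  also have "\<dots> = (\<Sum>c\<in>UNIV. fst u $ c * pdx c f z) + (\<Sum>c\<in>UNIV. snd u $ c * pdy c f z)"
    unfolding linear_add[OF lin] linear_sum[OF lin] linear_cmul[OF lin] pdx_def pdy_def by simp
  finally show ?thesis .
qed

lemma has_derivative_y_coord:
  fixes a :: "'n::finite"
  shows "(y_coord a has_derivative (\<lambda>u. snd u $ a)) (at z)"
proof -
  have "bounded_linear (\<lambda>u::(real^'n) \<times> (real^'n). snd u $ a)"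
    by (intro bounded_linear_compose[OF bounded_linear_vec_nth] bounded_linear_snd)
  then show ?thesis unfolding y_coord_def[abs_def] by (rule bounded_linear_imp_has_derivative)
qed

lemma D_vec0_y_coord:
  "D_vec0 \<omega> y_coord a z u = snd u $ a + (\<Sum>b\<in>UNIV. \<omega> a b z u * y_coord b z)"
  by (simp add: D_vec0_def extd0_def frechet_derivative_at[OF has_derivative_y_coord, symmetric])

text \<open>The identity \<open>y\<^sup>a D\<theta>\<^sub>a\<^sub>b = D(y\<^sup>a \<theta>\<^sub>a\<^sub>b) - Dy\<^sup>a \<and> \<theta>\<^sub>a\<^sub>b\<close> with vanishing first term on the right.\<close>

lemma y_coord_D_cov1:
  fixes \<theta> :: "'n::finite \<Rightarrow> 'n \<Rightarrow> ((real^'n) \<times> (real^'n)) form1"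
  assumes "open S" "z \<in> S"
    and diff: "\<And>a b u. (\<lambda>w. \<theta> a b w u) differentiable (at z)"
    and hom: "\<And>w b u. w \<in> S \<Longrightarrow> (\<Sum>a\<in>UNIV. y_coord a w * \<theta> a b w u) = 0"
  shows "(\<Sum>a\<in>UNIV. y_coord a z * D_cov1 \<omega> \<theta> a b z u v) =
         - (\<Sum>a\<in>UNIV. wedge (D_vec0 \<omega> y_coord a) (\<theta> a b) z u v)"
proof -
  \<comment> \<open>Differentiating the vanishing contraction trades y^a d\<theta> for dy^a; the
    connection terms in the index a will complete dy^a to Dy^a.\<close>
  have d: "(\<Sum>a\<in>UNIV. y_coord a z * frechet_derivative (\<lambda>w. \<theta> a b w v) (at z) u)
      = - (\<Sum>a\<in>UNIV. snd u $ a * \<theta> a b z v)" for u v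
  proof -
    have "((\<lambda>w. \<Sum>a\<in>UNIV. y_coord a w * \<theta> a b w v) has_derivative
       (\<lambda>u. \<Sum>a\<in>UNIV. y_coord a z * frechet_derivative (\<lambda>w. \<theta> a b w v) (at z) u
          + snd u $ a * \<theta> a b z v)) (at z)"
      using diff by (intro has_derivative_sum has_derivative_mult has_derivative_y_coord)
        (simp add: frechet_derivative_works[symmetric])
    then have "((\<lambda>w. 0) has_derivative
       (\<lambda>u. \<Sum>a\<in>UNIV. y_coord a z * frechet_derivative (\<lambda>w. \<theta> a b w v) (at z) u
          + snd u $ a * \<theta> a b z v)) (at z)"
      by (rule has_derivative_transform_within_open[OF _ assms(1,2)]) (simp add: hom)
    from has_derivative_unique[OF this has_derivative_const]
    have "(\<Sum>a\<in>UNIV. y_coord a z * frechet_derivative (\<lambda>w. \<theta> a b w v) (at z) u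
          + snd u $ a * \<theta> a b z v) = 0" by meson
    then show ?thesis by (simp add: sum.distrib)
  qed
  have 1: "(\<Sum>a\<in>UNIV. y_coord a z * extd1 (\<theta> a b) z u v) =
      - (\<Sum>a\<in>UNIV. snd u $ a * \<theta> a b z v - snd v $ a * \<theta> a b z u)"
    using d[of v u] d[of u v] by (simp add: extd1_def right_diff_distrib sum_subtractf)
  have "(\<Sum>a\<in>UNIV. y_coord a z * (\<Sum>c\<in>UNIV. wedge (\<omega> c a) (\<theta> c b) z u v)) =
     (\<Sum>a\<in>UNIV. \<Sum>c\<in>UNIV. y_coord a z * wedge (\<omega> c a) (\<theta> c b) z u v)"
    by (simp add: sum_distrib_left)
  also have "\<dots> = (\<Sum>c\<in>UNIV. \<Sum>a\<in>UNIV. y_coord a z * wedge (\<omega> c a) (\<theta> c b) z u v)"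
    by (rule sum.swap)
  finally have 2: "(\<Sum>a\<in>UNIV. y_coord a z * (\<Sum>c\<in>UNIV. wedge (\<omega> c a) (\<theta> c b) z u v)) =
     (\<Sum>c\<in>UNIV. (\<Sum>a\<in>UNIV. \<omega> c a z u * y_coord a z) * \<theta> c b z v
              - (\<Sum>a\<in>UNIV. \<omega> c a z v * y_coord a z) * \<theta> c b z u)"
    by (simp add: wedge_def sum_distrib_right sum_distrib_left sum_subtractf algebra_simps)
  have "(\<Sum>a\<in>UNIV. y_coord a z * (\<Sum>c\<in>UNIV. wedge (\<omega> c b) (\<theta> a c) z u v)) =
     (\<Sum>a\<in>UNIV. \<Sum>c\<in>UNIV. y_coord a z * wedge (\<omega> c b) (\<theta> a c) z u v)"
    by (simp add: sum_distrib_left)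
  also have "\<dots> = (\<Sum>c\<in>UNIV. \<Sum>a\<in>UNIV. y_coord a z * wedge (\<omega> c b) (\<theta> a c) z u v)"
    by (rule sum.swap)
  also have "\<dots> = (\<Sum>c\<in>UNIV. \<omega> c b z u * (\<Sum>a\<in>UNIV. y_coord a z * \<theta> a c z v)
              - \<omega> c b z v * (\<Sum>a\<in>UNIV. y_coord a z * \<theta> a c z u))"
    by (simp add: wedge_def sum_distrib_left sum_subtractf algebra_simps)
  \<comment> \<open>The connection terms in the free index contain the vanishing contraction
    itself.\<close>
  also have "\<dots> = 0" using hom[OF assms(2)] by simp
  finally have 3: "(\<Sum>a\<in>UNIV. y_coord a z * (\<Sum>c\<in>UNIV. wedge (\<omega> c b) (\<theta> a c) z u v)) = 0" .
  have "(\<Sum>a\<in>UNIV. y_coord a z * D_cov1 \<omega> \<theta> a b z u v) =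
     (\<Sum>a\<in>UNIV. y_coord a z * extd1 (\<theta> a b) z u v)
     - (\<Sum>a\<in>UNIV. y_coord a z * (\<Sum>c\<in>UNIV. wedge (\<omega> c a) (\<theta> c b) z u v))
     - (\<Sum>a\<in>UNIV. y_coord a z * (\<Sum>c\<in>UNIV. wedge (\<omega> c b) (\<theta> a c) z u v))"
    by (simp add: D_cov1_def right_diff_distrib sum_subtractf)
  also have "\<dots> = - (\<Sum>a\<in>UNIV. wedge (D_vec0 \<omega> y_coord a) (\<theta> a b) z u v)"
    unfolding 1 2 3
    unfolding wedge_def D_vec0_y_coord
    by (simp add: sum_subtractf sum.distrib algebra_simps)
  finally show ?thesis .
qed

section \<open>Metrics subject to the Euler identity, in one chart\<close>

lemma sum_half_combination:
  fixes w X Y Z :: "'i \<Rightarrow> real"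
  shows "(\<Sum>c\<in>I. w c * ((1/2) * (X c + Y c - Z c)))
    = (1/2) * ((\<Sum>c\<in>I. w c * X c) + (\<Sum>c\<in>I. w c * Y c) - (\<Sum>c\<in>I. w c * Z c))"
  by (simp add: sum.distrib sum_subtractf sum_distrib_left ring_distribs flip: sum_divide_distrib)

lemma sum_axis:
  fixes c :: "'n::finite" and f :: "'n \<Rightarrow> real"
  shows "(\<Sum>b\<in>UNIV. axis c 1 $ b * f b) = f c" "(\<Sum>b\<in>UNIV. f b * axis c 1 $ b) = f c"
  by (simp_all add: axis_def if_distrib[where f = "\<lambda>x. x * _"] if_distrib[where f = "\<lambda>x. _ * x"]
      cong: if_cong)

text \<open>\<open>S\<close> stands for a coordinate domain of the slit bundle and \<open>l\<close>
  for the Lagrangian in coordinates. \<open>euler_G\<close> is what the homogeneity condition says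
  about vertical vectors. All identities are confined to \<open>S\<close>, since values outside have
  no meaning.\<close>

locale chart_metric =
  fixes S :: "((real^'n) \<times> (real^'n)) set" and G :: "'n \<Rightarrow> 'n \<Rightarrow> (real^'n) \<times> (real^'n) \<Rightarrow> real"
    and l :: "(real^'n) \<times> (real^'n) \<Rightarrow> real"
  assumes open_S: "open S"
    and smooth_G: "smooth_on S (G a b)"
    and sym_G: "z \<in> S \<Longrightarrow> G a b z = G b a z"
    and invertible_G: "z \<in> S \<Longrightarrow> invertible (\<chi> i j. G i j z)"
    and euler_G: "z \<in> S \<Longrightarrow> (\<Sum>a\<in>UNIV. y_coord a z * pdy c (G a b) z) = 0"
    and l_eq: "z \<in> S \<Longrightarrow> l z = (1/2) * (\<Sum>a\<in>UNIV. \<Sum>b\<in>UNIV. y_coord a z * y_coord b z * G a b z)"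
begin

lemma has_derivative_G: "z \<in> S \<Longrightarrow> (G a b has_derivative frechet_derivative (G a b) (at z)) (at z)"
  by (rule smooth_on_has_derivative[OF smooth_G open_S])

lemma euler_G': "z \<in> S \<Longrightarrow> (\<Sum>b\<in>UNIV. y_coord b z * pdy c (G a b) z) = 0"
  using euler_G[of z c a] pdy_cong[OF open_S, of z "G a b" "G b a" c for b] sym_G by simp

lemma pdx_G_sym: "z \<in> S \<Longrightarrow> pdx d (G a b) z = pdx d (G b a) z"
  by (rule pdx_cong[OF open_S _ sym_G])

lemma has_derivative_l:
  assumes "z \<in> S"
  shows "(l has_derivative (\<lambda>u. (1/2) * (\<Sum>a\<in>UNIV. \<Sum>b\<in>UNIV.
      y_coord a z * y_coord b z * frechet_derivative (G a b) (at z) u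
      + (y_coord a z * (snd u $ b) + (snd u $ a) * y_coord b z) * G a b z))) (at z)"
proof -
  have "((\<lambda>z. (1/2) * (\<Sum>a\<in>UNIV. \<Sum>b\<in>UNIV. y_coord a z * y_coord b z * G a b z)) has_derivative
    (\<lambda>u. (1/2) * (\<Sum>a\<in>UNIV. \<Sum>b\<in>UNIV.
      y_coord a z * y_coord b z * frechet_derivative (G a b) (at z) u
      + (y_coord a z * (snd u $ b) + (snd u $ a) * y_coord b z) * G a b z))) (at z)"
    by (intro has_derivative_mult_right has_derivative_sum has_derivative_mult
        has_derivative_y_coord has_derivative_G assms)
  then show ?thesis
    by (rule has_derivative_transform_within_open[OF _ open_S assms]) (simp add: l_eq)
qed

lemma pdx_l:
  assumes "z \<in> S"
  shows "pdx d l z = (1/2) * (\<Sum>a\<in>UNIV. \<Sum>b\<in>UNIV. y_coord a z * y_coord b z * pdx d (G a b) z)"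
  using pdx_eqI[OF has_derivative_l[OF assms], of d] by (simp add: pdx_def)

text \<open>Of the three product-rule terms, the one that differentiates \<open>G\<close> vanishes
  by \<open>euler_G'\<close>, and the other two agree by symmetry and absorb the factor 1/2.\<close>

lemma pdy_l:
  assumes "z \<in> S"
  shows "pdy c l z = (\<Sum>b\<in>UNIV. G c b z * y_coord b z)"
proof -
  have "pdy c l z = (1/2) * (\<Sum>a\<in>UNIV. \<Sum>b\<in>UNIV. y_coord a z * y_coord b z * pdy c (G a b) z
      + (y_coord a z * (axis c 1 $ b) + (axis c 1 $ a) * y_coord b z) * G a b z)"
    using pdy_eqI[OF has_derivative_l[OF assms], of c] by (simp add: pdy_def)
  also have "\<dots> = (1/2) * ((\<Sum>a\<in>UNIV. y_coord a z * (\<Sum>b\<in>UNIV. y_coord b z * pdy c (G a b) z))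
      + (\<Sum>a\<in>UNIV. y_coord a z * (\<Sum>b\<in>UNIV. (axis c 1 $ b) * G a b z))
      + (\<Sum>a\<in>UNIV. (axis c 1 $ a) * (\<Sum>b\<in>UNIV. y_coord b z * G a b z)))"
    by (simp add: sum.distrib sum_distrib_left sum_distrib_right algebra_simps)
  also have "\<dots> = (\<Sum>b\<in>UNIV. G c b z * y_coord b z)"
    unfolding sum_axis euler_G'[OF assms] by (simp add: sym_G[OF assms, of _ c] mult.commute)
  finally show ?thesis .
qed

lemma has_derivative_pdy_l:
  assumes "z \<in> S"
  shows "(pdy c l has_derivative (\<lambda>u. \<Sum>b\<in>UNIV. G c b z * (snd u $ b)
      + frechet_derivative (G c b) (at z) u * y_coord b z)) (at z)"
proof -
  have "((\<lambda>z. \<Sum>b\<in>UNIV. G c b z * y_coord b z) has_derivative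
    (\<lambda>u. \<Sum>b\<in>UNIV. G c b z * (snd u $ b)
      + frechet_derivative (G c b) (at z) u * y_coord b z)) (at z)"
    by (intro has_derivative_sum has_derivative_mult has_derivative_y_coord has_derivative_G assms)
  then show ?thesis
    by (rule has_derivative_transform_within_open[OF _ open_S assms]) (simp add: pdy_l)
qed

text \<open>In the vertical derivative of g_bd y^d the term with the derivative of \<open>G\<close>
  drops by the Euler identity once more.\<close>

lemma vhess_l:
  assumes "z \<in> S"
  shows "vhess l a b z = G a b z"
proof -
  have "vhess l a b z = (\<Sum>d\<in>UNIV. axis a 1 $ d * G b d z) + (\<Sum>d\<in>UNIV. y_coord d z * pdy a (G b d) z)"
    unfolding vhess_def pdy_eqI[OF has_derivative_pdy_l[OF assms]]
    by (simp add: sum.distrib pdy_def mult.commute)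
  then show ?thesis unfolding sum_axis euler_G'[OF assms] by (simp add: sym_G[OF assms])
qed

lemma pdx_pdy_l:
  assumes "z \<in> S"
  shows "pdx c (pdy d l) z = (\<Sum>b\<in>UNIV. y_coord b z * pdx c (G d b) z)"
  unfolding pdx_eqI[OF has_derivative_pdy_l[OF assms]] by (simp add: pdx_def mult.commute)

text \<open>Raising an index undoes lowering it. The later identities are proved with the index
  lowered by \<open>G\<close> and transferred through this, with \<open>w\<close> chosen
  accordingly.\<close>

lemma vhess_inv_cancel:
  assumes "z \<in> S"
  shows "(\<Sum>n\<in>UNIV. vhess_inv l a n z * (\<Sum>e\<in>UNIV. G n e z * w e)) = w a"
proof -
  let ?M = "\<chi> i j. G i j z"
  \<comment> \<open>\<open>matrix_inv\<close> is a choice among inverses, which exist by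
    \<open>invertible_G\<close>.\<close>
  have "matrix_inv ?M ** ?M = mat 1"
    using invertible_G[OF assms] by (simp add: matrix_inv_def invertible_def) (metis (mono_tags, lifting) someI_ex)
  then have "matrix_inv ?M *v (?M *v (\<chi> e. w e)) = (\<chi> e. w e)"
    by (simp add: matrix_vector_mul_assoc)
  then have "(matrix_inv ?M *v (?M *v (\<chi> e. w e))) $ a = w a" by simp
  then show ?thesis by (simp add: matrix_vector_mult_def vhess_inv_def vhess_l[OF assms])
qed

text \<open>The quotient \<phi> of \<open>l\<close> by t^2 along the ray has derivative zero on the
  positive half-line, which is convex, so its values at s and 1 coincide. The whole open ray has to
  lie in \<open>S\<close> for this comparison.\<close>

lemma l_homogeneous:
  assumes ray: "\<And>t. t > 0 \<Longrightarrow> (x, t *\<^sub>R y) \<in> S" and "s > 0"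
  shows "l (x, s *\<^sub>R y) = s\<^sup>2 * l (x, y)"
proof -
  define \<phi> where "\<phi> t = l (x, t *\<^sub>R y) / t\<^sup>2" for t
  have "(\<phi> has_field_derivative 0) (at t within {0<..})" if "t \<in> {0<..}" for t
  proof -
    have t: "t > 0" using that by simp
    let ?z = "(x, t *\<^sub>R y)"
    have zS: "?z \<in> S" using ray t by simp
    have dif: "l differentiable (at ?z)"
      using has_derivative_l[OF zS] differentiableI by blast
    let ?D = "frechet_derivative l (at ?z)"
    \<comment> \<open>Euler's identity: (0, t y) is the fibre position vector at the point (x, t
      y).\<close>
    have "?D (0, t *\<^sub>R y) = (\<Sum>c\<in>UNIV. y_coord c ?z * pdy c l ?z)"
      unfolding frechet_derivative_partials[OF dif] by (simp add: y_coord_def)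
    also have "\<dots> = 2 * l ?z"
      by (simp add: pdy_l[OF zS] l_eq[OF zS] sum_distrib_left mult_ac)
    finally have eu: "?D (0, t *\<^sub>R y) = 2 * l ?z" .
    have lin: "linear ?D" by (rule linear_frechet_derivative[OF dif])
    have "((\<lambda>t. (x, t *\<^sub>R y)) has_derivative (\<lambda>h. (0, h *\<^sub>R y))) (at t)"
      by (auto intro!: derivative_eq_intros)
    from diff_chain_at[OF this dif[unfolded frechet_derivative_works]]
    have chain: "((\<lambda>t. l (x, t *\<^sub>R y)) has_derivative (\<lambda>h. ?D (0, h *\<^sub>R y))) (at t)"
      by (simp add: o_def)
    have "?D (0, h *\<^sub>R y) = 2 * l ?z / t * h" for h
    proof -
      have "?D (0, h *\<^sub>R y) = ?D ((h / t) *\<^sub>R (0, t *\<^sub>R y))" using t by simp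
      also have "\<dots> = (h / t) * ?D (0, t *\<^sub>R y)" unfolding linear_cmul[OF lin] by simp
      finally have "?D (0, h *\<^sub>R y) = (h / t) * ?D (0, t *\<^sub>R y)" .
      then show ?thesis using eu by simp
    qed
    then have "(\<lambda>h. ?D (0, h *\<^sub>R y)) = (*) (2 * l ?z / t)" by auto
    with chain have "((\<lambda>t. l (x, t *\<^sub>R y)) has_field_derivative 2 * l ?z / t) (at t)"
      by (simp add: has_field_derivative_def)
    then have "(\<phi> has_field_derivative 0) (at t)"
      unfolding \<phi>_def using t
      by (auto intro!: derivative_eq_intros simp: field_simps power2_eq_square power_numeral_reduce)
    then show ?thesis by (rule has_field_derivative_at_within)
  qed
  then obtain k where "\<And>t. t \<in> {0<..} \<Longrightarrow> \<phi> t = k"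
    using has_field_derivative_zero_constant[of "{0<..}" \<phi>] by blast
  then have "\<phi> s = \<phi> 1" using \<open>s > 0\<close> by simp
  then show ?thesis using \<open>s > 0\<close> by (simp add: \<phi>_def field_simps)
qed

text \<open>The partial derivatives commute, and differentiation in x does not see the factor y, so
  this is the x-derivative of the Euler identity. It disposes of the second derivatives of
  \<open>G\<close>.\<close>

lemma pdy_pdx_contraction:
  assumes "z \<in> S"
  shows "(\<Sum>e\<in>UNIV. y_coord e z * pdy c (pdx b (G n e)) z) = 0"
proof -
  have com: "pdy c (pdx b (G n e)) z = pdx b (pdy c (G n e)) z" for e
    unfolding pdx_def pdy_def by (rule frechet_derivative_commute[OF open_S assms smooth_G])
  have d: "(pdy c (G n e) has_derivative frechet_derivative (pdy c (G n e)) (at z)) (at z)" for e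
    unfolding pdy_def
    by (rule smooth_on_has_derivative[OF smooth_on_derivative[OF smooth_G] open_S assms])
  have "((\<lambda>z. \<Sum>e\<in>UNIV. y_coord e z * pdy c (G n e) z) has_derivative
    (\<lambda>u. \<Sum>e\<in>UNIV. y_coord e z * frechet_derivative (pdy c (G n e)) (at z) u
        + (snd u $ e) * pdy c (G n e) z)) (at z)"
    by (intro has_derivative_sum has_derivative_mult has_derivative_y_coord d)
  from pdx_eqI[OF this, of b]
  have "pdx b (\<lambda>z. \<Sum>e\<in>UNIV. y_coord e z * pdy c (G n e) z) z
      = (\<Sum>e\<in>UNIV. y_coord e z * pdx b (pdy c (G n e)) z)"
    by (simp add: pdx_def)
  moreover have "pdx b (\<lambda>z. \<Sum>e\<in>UNIV. y_coord e z * pdy c (G n e) z) z = pdx b (\<lambda>z. 0) z"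
    by (rule pdx_cong[OF open_S assms]) (simp add: euler_G')
  ultimately show ?thesis by (simp add: com pdx_def)
qed

text \<open>The covector is quadratic in y with coefficients built from x-derivatives of
  \<open>G\<close>. Its vertical derivative differentiates either a factor y, which gives the terms
  on the right, or a coefficient, and those terms vanish by
  \<open>pdy_pdx_contraction\<close>.\<close>

lemma pdy_spray_covector:
  assumes "z \<in> S"
  shows "pdy c (\<lambda>z. (\<Sum>b\<in>UNIV. pdx b (pdy n l) z * y_coord b z) - pdx n l z) z =
     (\<Sum>b\<in>UNIV. y_coord b z * pdx c (G n b) z) + (\<Sum>b\<in>UNIV. y_coord b z * pdx b (G n c) z)
     - (\<Sum>b\<in>UNIV. y_coord b z * pdx n (G c b) z)" (is "pdy c ?E z = _")
proof -
  have d: "(pdx b (G n e) has_derivative frechet_derivative (pdx b (G n e)) (at z)) (at z)" for b n e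
    unfolding pdx_def
    by (rule smooth_on_has_derivative[OF smooth_on_derivative[OF smooth_G] open_S assms])
  have E: "?E w = (\<Sum>b\<in>UNIV. \<Sum>e\<in>UNIV. y_coord e w * y_coord b w * pdx b (G n e) w)
      - (1/2) * (\<Sum>a\<in>UNIV. \<Sum>b\<in>UNIV. y_coord a w * y_coord b w * pdx n (G a b) w)" if "w \<in> S" for w
    unfolding pdx_pdy_l[OF that] pdx_l[OF that] by (simp add: sum_distrib_right sum_distrib_left mult_ac)
  have "((\<lambda>w. (\<Sum>b\<in>UNIV. \<Sum>e\<in>UNIV. y_coord e w * y_coord b w * pdx b (G n e) w)
      - (1/2) * (\<Sum>a\<in>UNIV. \<Sum>b\<in>UNIV. y_coord a w * y_coord b w * pdx n (G a b) w)) has_derivative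
     (\<lambda>u. (\<Sum>b\<in>UNIV. \<Sum>e\<in>UNIV. y_coord e z * y_coord b z * frechet_derivative (pdx b (G n e)) (at z) u
          + (y_coord e z * (snd u $ b) + (snd u $ e) * y_coord b z) * pdx b (G n e) z)
      - (1/2) * (\<Sum>a\<in>UNIV. \<Sum>b\<in>UNIV. y_coord a z * y_coord b z * frechet_derivative (pdx n (G a b)) (at z) u
          + (y_coord a z * (snd u $ b) + (snd u $ a) * y_coord b z) * pdx n (G a b) z))) (at z)"
    by (intro has_derivative_diff has_derivative_mult_right has_derivative_sum has_derivative_mult
        has_derivative_y_coord d)
  note pdy_eqI[OF this, of c]
  then have "pdy c ?E z = (\<Sum>b\<in>UNIV. \<Sum>e\<in>UNIV. y_coord e z * y_coord b z * pdy c (pdx b (G n e)) z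
          + (y_coord e z * (axis c 1 $ b) + (axis c 1 $ e) * y_coord b z) * pdx b (G n e) z)
      - (1/2) * (\<Sum>a\<in>UNIV. \<Sum>b\<in>UNIV. y_coord a z * y_coord b z * pdy c (pdx n (G a b)) z
          + (y_coord a z * (axis c 1 $ b) + (axis c 1 $ a) * y_coord b z) * pdx n (G a b) z)"
    by (subst pdy_cong[OF open_S assms E]) (simp_all add: pdy_def)
  also have "\<dots> = (\<Sum>b\<in>UNIV. y_coord b z * (\<Sum>e\<in>UNIV. y_coord e z * pdy c (pdx b (G n e)) z))
      + (\<Sum>b\<in>UNIV. (axis c 1 $ b) * (\<Sum>e\<in>UNIV. y_coord e z * pdx b (G n e) z))
      + (\<Sum>b\<in>UNIV. y_coord b z * (\<Sum>e\<in>UNIV. (axis c 1 $ e) * pdx b (G n e) z))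
      - (1/2) * ((\<Sum>a\<in>UNIV. y_coord a z * (\<Sum>b\<in>UNIV. y_coord b z * pdy c (pdx n (G a b)) z))
      + (\<Sum>a\<in>UNIV. y_coord a z * (\<Sum>b\<in>UNIV. (axis c 1 $ b) * pdx n (G a b) z))
      + (\<Sum>a\<in>UNIV. (axis c 1 $ a) * (\<Sum>b\<in>UNIV. y_coord b z * pdx n (G a b) z)))"
    by (simp add: sum.distrib sum_distrib_left sum_distrib_right algebra_simps)
  also have "\<dots> = (\<Sum>b\<in>UNIV. y_coord b z * pdx c (G n b) z) + (\<Sum>b\<in>UNIV. y_coord b z * pdx b (G n c) z)
     - (\<Sum>b\<in>UNIV. y_coord b z * pdx n (G c b) z)"
    unfolding sum_axis pdy_pdx_contraction[OF assms]
    using pdx_G_sym[OF assms, of n _ c] by simp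
  finally show ?thesis .
qed

end

text \<open>The assumptions are the conditions on a horizontal connection with coefficients
  \<open>H\<close>: \<open>sym_H\<close> is vanishing torsion, \<open>pdy_G_sym\<close> is almost
  metric compatibility on two vertical vectors, and \<open>horizontal_compat\<close> says that Dg
  vanishes on the vectors annihilated by Dy.\<close>

locale chart_chern = chart_metric S G l
  for S :: "((real^'n) \<times> (real^'n)) set" and G l +
  fixes H :: "'n \<Rightarrow> 'n \<Rightarrow> 'n \<Rightarrow> (real^'n) \<times> (real^'n) \<Rightarrow> real"
  assumes sym_H: "z \<in> S \<Longrightarrow> H a b c z = H a c b z"
    and differentiable_H: "z \<in> S \<Longrightarrow> H a b c differentiable (at z)"
    and pdy_G_sym: "z \<in> S \<Longrightarrow> pdy c (G a b) z = pdy b (G a c) z"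
    and horizontal_compat: "z \<in> S \<Longrightarrow>
      pdx d (G a b) z - (\<Sum>c\<in>UNIV. (\<Sum>e\<in>UNIV. H c e d z * y_coord e z) * pdy c (G a b) z) =
      (\<Sum>e\<in>UNIV. H e a d z * G e b z) + (\<Sum>e\<in>UNIV. H e b d z * G a e z)"
begin

section \<open>Koszul formula and identification with the Barthel connection\<close>

definition N where "N c d z = (\<Sum>e\<in>UNIV. H c e d z * y_coord e z)"

text \<open>The derivative of \<open>G a b\<close> along the horizontal lift for \<open>N\<close>,
  where Dy^c = dy^c + N^c_d dx^d. It is formed with the non-linear connection of \<open>H\<close>;
  the agreement with \<open>hdelta\<close> has to wait for \<open>barthel_eq\<close>.\<close>

definition \<delta> where "\<delta> d a b z = pdx d (G a b) z - (\<Sum>c\<in>UNIV. N c d z * pdy c (G a b) z)"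

text \<open>The Levi-Civita argument: with the upper index lowered, compatibility splits each
  \<open>\<delta>\<close> into two values of \<open>K\<close>, and the symmetry of \<open>K\<close>
  in its last two indices isolates one of them in the alternating sum.\<close>

lemma koszul:
  assumes "z \<in> S"
  shows "(\<Sum>e\<in>UNIV. G n e z * H e b c z) = (1/2) * (\<delta> b n c z + \<delta> c n b z - \<delta> n b c z)"
proof -
  define K where "K a b c = (\<Sum>e\<in>UNIV. G a e z * H e b c z)" for a b c
  have K_sym: "K a b c = K a c b" for a b c using sym_H[OF assms] by (simp add: K_def)
  have "\<delta> d a b z = K b a d + K a b d" for a b d
    using horizontal_compat[OF assms, of d a b] sym_G[OF assms]
    by (simp add: \<delta>_def N_def K_def mult.commute)
  then have "\<delta> b n c z + \<delta> c n b z - \<delta> n b c z = 2 * K n b c"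
    using K_sym[of c n b] K_sym[of n c b] K_sym[of b n c] by simp
  then show ?thesis by (simp add: K_def)
qed

text \<open>When a metric index is contracted, each coefficient of \<open>N\<close> carries a
  contraction that vanishes by the Euler identity.\<close>

lemma delta_contraction:
  assumes "z \<in> S"
  shows "(\<Sum>b\<in>UNIV. y_coord b z * \<delta> d a b z) = (\<Sum>b\<in>UNIV. y_coord b z * pdx d (G a b) z)"
    and "(\<Sum>b\<in>UNIV. y_coord b z * \<delta> d b a z) = (\<Sum>b\<in>UNIV. y_coord b z * pdx d (G b a) z)"
proof -
  have "(\<Sum>b\<in>UNIV. y_coord b z * (\<Sum>c\<in>UNIV. N c d z * pdy c (F b) z))
      = (\<Sum>c\<in>UNIV. N c d z * (\<Sum>b\<in>UNIV. y_coord b z * pdy c (F b) z))" for F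
    unfolding sum_distrib_left by (subst sum.swap) (simp add: mult_ac)
  from this[of "G a"] this[of "\<lambda>b. G b a"]
  show "(\<Sum>b\<in>UNIV. y_coord b z * \<delta> d a b z) = (\<Sum>b\<in>UNIV. y_coord b z * pdx d (G a b) z)"
    and "(\<Sum>b\<in>UNIV. y_coord b z * \<delta> d b a z) = (\<Sum>b\<in>UNIV. y_coord b z * pdx d (G b a) z)"
    by (simp_all add: \<delta>_def right_diff_distrib sum_subtractf euler_G[OF assms] euler_G'[OF assms])
qed

lemma G_contraction:
  "(\<Sum>e\<in>UNIV. G n e z * (\<Sum>b\<in>UNIV. y_coord b z * F e b))
    = (\<Sum>b\<in>UNIV. y_coord b z * (\<Sum>e\<in>UNIV. G n e z * F e b))"
  unfolding sum_distrib_left by (subst sum.swap) (simp add: mult_ac)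

text \<open>The Koszul formula contracted once. Two of the three terms are contracted in a metric
  index and lose \<open>N\<close>; the first is contracted in the derivative index and keeps
  it.\<close>

lemma N_lower:
  assumes "z \<in> S"
  shows "(\<Sum>e\<in>UNIV. G n e z * N e c z) = (1/2) * ((\<Sum>b\<in>UNIV. y_coord b z * \<delta> b n c z)
     + (\<Sum>b\<in>UNIV. y_coord b z * pdx c (G n b) z) - (\<Sum>b\<in>UNIV. y_coord b z * pdx n (G b c) z))"
proof -
  have "(\<Sum>e\<in>UNIV. G n e z * N e c z)
      = (\<Sum>b\<in>UNIV. y_coord b z * (\<Sum>e\<in>UNIV. G n e z * H e b c z))"
    using G_contraction[of n z "\<lambda>e b. H e b c z"] by (simp add: N_def mult.commute)
  also have "\<dots> = (1/2) * ((\<Sum>b\<in>UNIV. y_coord b z * \<delta> b n c z) + (\<Sum>b\<in>UNIV. y_coord b z * \<delta> c n b z)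
      - (\<Sum>b\<in>UNIV. y_coord b z * \<delta> n b c z))"
    unfolding koszul[OF assms]
    by (rule sum_half_combination)
  finally show ?thesis unfolding delta_contraction[OF assms] .
qed

text \<open>In the second contraction the remaining \<open>\<delta>\<close> is contracted in a
  metric index as well. The first two terms then coincide, and the third gives 2
  \<open>pdx n l\<close>, since \<open>l\<close> carries the factor 1/2.\<close>

lemma spray_covector:
  assumes "z \<in> S"
  shows "(\<Sum>c\<in>UNIV. pdx c (pdy n l) z * y_coord c z) - pdx n l z
    = (\<Sum>e\<in>UNIV. G n e z * (\<Sum>c\<in>UNIV. y_coord c z * N e c z))"
proof -
  have "(\<Sum>c\<in>UNIV. y_coord c z * (\<Sum>b\<in>UNIV. y_coord b z * \<delta> b n c z))
      = (\<Sum>b\<in>UNIV. y_coord b z * (\<Sum>c\<in>UNIV. y_coord c z * \<delta> b n c z))"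
    unfolding sum_distrib_left by (subst sum.swap) (simp add: mult_ac)
  also have "\<dots> = (\<Sum>b\<in>UNIV. y_coord b z * pdx b (pdy n l) z)"
    unfolding delta_contraction[OF assms] pdx_pdy_l[OF assms] ..
  finally have 1: "(\<Sum>c\<in>UNIV. y_coord c z * (\<Sum>b\<in>UNIV. y_coord b z * \<delta> b n c z))
      = (\<Sum>b\<in>UNIV. y_coord b z * pdx b (pdy n l) z)" .
  have 2: "(\<Sum>c\<in>UNIV. y_coord c z * (\<Sum>b\<in>UNIV. y_coord b z * pdx c (G n b) z))
      = (\<Sum>b\<in>UNIV. y_coord b z * pdx b (pdy n l) z)"
    unfolding pdx_pdy_l[OF assms] ..
  have 3: "(\<Sum>c\<in>UNIV. y_coord c z * (\<Sum>b\<in>UNIV. y_coord b z * pdx n (G b c) z)) = 2 * pdx n l z"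
    by (simp add: pdx_l[OF assms] sum_distrib_left mult_ac pdx_G_sym[OF assms])
  have "(\<Sum>e\<in>UNIV. G n e z * (\<Sum>c\<in>UNIV. y_coord c z * N e c z))
      = (\<Sum>c\<in>UNIV. y_coord c z * (\<Sum>e\<in>UNIV. G n e z * N e c z))"
    by (rule G_contraction)
  also have "\<dots> = (1/2) * ((\<Sum>c\<in>UNIV. y_coord c z * (\<Sum>b\<in>UNIV. y_coord b z * \<delta> b n c z))
     + (\<Sum>c\<in>UNIV. y_coord c z * (\<Sum>b\<in>UNIV. y_coord b z * pdx c (G n b) z))
     - (\<Sum>c\<in>UNIV. y_coord c z * (\<Sum>b\<in>UNIV. y_coord b z * pdx n (G b c) z)))"
    unfolding N_lower[OF assms]
    by (rule sum_half_combination)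
  also have "\<dots> = (\<Sum>c\<in>UNIV. pdx c (pdy n l) z * y_coord c z) - pdx n l z"
    unfolding 1 2 3 by (simp add: mult.commute)
  finally show ?thesis by simp
qed

lemma spray_eq:
  assumes "z \<in> S"
  shows "spray l a z = (1/2) * (\<Sum>c\<in>UNIV. y_coord c z * N a c z)"
  unfolding spray_def spray_covector[OF assms] vhess_inv_cancel[OF assms] ..

text \<open>\<open>spray l\<close> is defined through an inverse matrix. Its expression by
  \<open>N\<close> gives differentiability from that of \<open>H\<close>, without differentiating
  the inverse.\<close>

lemma differentiable_spray:
  assumes "z \<in> S"
  shows "spray l a differentiable (at z)"
proof -
  have "(\<lambda>z. (1/2) * (\<Sum>c\<in>UNIV. y_coord c z * (\<Sum>e\<in>UNIV. H a e c z * y_coord e z))) differentiable (at z)"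
    by (intro differentiable_mult differentiable_sum differentiable_const ballI finite
        differentiable_H assms differentiableI[OF has_derivative_y_coord])
  then obtain D where "((\<lambda>z. (1/2) * (\<Sum>c\<in>UNIV. y_coord c z * (\<Sum>e\<in>UNIV. H a e c z * y_coord e z)))
      has_derivative D) (at z)"
    by (auto simp: differentiable_def)
  then have "(spray l a has_derivative D) (at z)"
    by (rule has_derivative_transform_within_open[OF _ open_S assms]) (simp add: spray_eq N_def)
  then show ?thesis by (rule differentiableI)
qed

text \<open>The vertical derivative of 2 g_ne G^e consists of 2 g_ne \<partial>G^e/\<partial>y^c and
  the residue 2 (\<partial>g_ne/\<partial>y^c) G^e. In \<open>N_lower\<close> the surviving
  \<open>N\<close> enters as N^e_b y^b = 2 G^e times \<partial>g_nc/\<partial>y^e, which is the same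
  residue by \<open>pdy_G_sym\<close>. The remaining terms agree by
  \<open>pdy_spray_covector\<close>.\<close>

lemma barthel_eq:
  assumes "z \<in> S"
  shows "barthel l a c z = N a c z"
proof -
  have lower: "(\<Sum>e\<in>UNIV. G n e z * barthel l e c z) = (\<Sum>e\<in>UNIV. G n e z * N e c z)" for n
  proof -
    have "((\<lambda>w. 2 * (\<Sum>e\<in>UNIV. G n e w * spray l e w)) has_derivative
      (\<lambda>u. 2 * (\<Sum>e\<in>UNIV. G n e z * frechet_derivative (spray l e) (at z) u
          + frechet_derivative (G n e) (at z) u * spray l e z))) (at z)"
      using differentiable_spray[OF assms]
      by (intro has_derivative_mult_right has_derivative_sum has_derivative_mult has_derivative_G assms)
         (simp add: frechet_derivative_works[symmetric])
    from pdy_eqI[OF this, of c]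
    have "pdy c (\<lambda>w. 2 * (\<Sum>e\<in>UNIV. G n e w * spray l e w)) z
        = 2 * (\<Sum>e\<in>UNIV. G n e z * barthel l e c z) + 2 * (\<Sum>e\<in>UNIV. pdy c (G n e) z * spray l e z)"
      by (simp add: pdy_def barthel_def sum.distrib)
    moreover have "pdy c (\<lambda>w. 2 * (\<Sum>e\<in>UNIV. G n e w * spray l e w)) z =
        pdy c (\<lambda>z. (\<Sum>b\<in>UNIV. pdx b (pdy n l) z * y_coord b z) - pdx n l z) z"
    proof (rule pdy_cong[OF open_S assms])
      fix w assume w: "w \<in> S"
      show "2 * (\<Sum>e\<in>UNIV. G n e w * spray l e w)
          = (\<Sum>b\<in>UNIV. pdx b (pdy n l) w * y_coord b w) - pdx n l w"
        unfolding spray_covector[OF w] by (simp add: spray_eq[OF w] sum_distrib_left mult_ac)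
    qed
    ultimately have 1: "2 * (\<Sum>e\<in>UNIV. G n e z * barthel l e c z) =
        (\<Sum>b\<in>UNIV. y_coord b z * pdx c (G n b) z) + (\<Sum>b\<in>UNIV. y_coord b z * pdx b (G n c) z)
        - (\<Sum>b\<in>UNIV. y_coord b z * pdx n (G c b) z) - 2 * (\<Sum>e\<in>UNIV. pdy c (G n e) z * spray l e z)"
      unfolding pdy_spray_covector[OF assms] by simp
    \<comment> \<open>The \<open>N\<close> part of the surviving contraction, brought into the form
      of the product-rule residue in the equation above.\<close>
    have "(\<Sum>b\<in>UNIV. y_coord b z * (\<Sum>e\<in>UNIV. N e b z * pdy e (G n c) z))
       = (\<Sum>e\<in>UNIV. (\<Sum>b\<in>UNIV. y_coord b z * N e b z) * pdy e (G n c) z)"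
      unfolding sum_distrib_left sum_distrib_right by (subst sum.swap) (simp add: mult_ac)
    also have "\<dots> = 2 * (\<Sum>e\<in>UNIV. pdy c (G n e) z * spray l e z)"
      unfolding spray_eq[OF assms] pdy_G_sym[OF assms, of _ n c]
      by (simp add: sum_distrib_left mult_ac)
    finally have 2: "(\<Sum>b\<in>UNIV. y_coord b z * \<delta> b n c z) = (\<Sum>b\<in>UNIV. y_coord b z * pdx b (G n c) z)
       - 2 * (\<Sum>e\<in>UNIV. pdy c (G n e) z * spray l e z)"
      by (simp add: \<delta>_def right_diff_distrib sum_subtractf)
    show ?thesis
      using 1 N_lower[OF assms, of n c] 2 pdx_G_sym[OF assms, of n _ c] by simp
  qed
  show ?thesis
    using vhess_inv_cancel[OF assms, of a "\<lambda>e. barthel l e c z"]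
      vhess_inv_cancel[OF assms, of a "\<lambda>e. N e c z"] lower by simp
qed

text \<open>With the Barthel connection replaced by \<open>N\<close>, \<open>hdelta\<close> becomes
  \<open>\<delta>\<close>, and the Chern coefficient is the Koszul expression with its index
  raised.\<close>

lemma chern_coeff_eq:
  assumes "z \<in> S"
  shows "chern_coeff l a b c z = H a b c z"
proof -
  have hd: "hdelta l d (vhess l n e) z = \<delta> d n e z" for d n e
    unfolding hdelta_def \<delta>_def barthel_eq[OF assms]
    using pdx_cong[OF open_S assms vhess_l] pdy_cong[OF open_S assms vhess_l] by simp
  have "chern_coeff l a b c z = (\<Sum>n\<in>UNIV. vhess_inv l a n z *
      ((1/2) * (\<delta> b n c z + \<delta> c n b z - \<delta> n b c z)))"
    unfolding chern_coeff_def hd by (simp add: sum_distrib_left)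
  also have "\<dots> = H a b c z"
    unfolding koszul[OF assms, symmetric] by (rule vhess_inv_cancel[OF assms])
  finally show ?thesis .
qed

end

section \<open>Tangent vectors and induced charts\<close>

context
  fixes A :: "('p, 'e::euclidean_space) chart set"
  assumes atlas: "smooth_atlas A"
begin

lemma chart_inv_apply: "c \<in> A \<Longrightarrow> p \<in> fst c \<Longrightarrow> chart_inv c (snd c p) = p"
  using atlas by (simp add: smooth_atlas_def chart_inv_def inv_into_f_f)

lemma transition_apply: "c \<in> A \<Longrightarrow> p \<in> fst c \<Longrightarrow> transition c c' (snd c p) = snd c' p"
  by (simp add: transition_def chart_inv_apply)

lemma open_chart_overlap: "c \<in> A \<Longrightarrow> c' \<in> A \<Longrightarrow> open (snd c ` (fst c \<inter> fst c'))"
  and smooth_on_transition: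
    "c \<in> A \<Longrightarrow> c' \<in> A \<Longrightarrow> smooth_on (snd c ` (fst c \<inter> fst c')) (transition c c')"
  using atlas by (auto simp: smooth_atlas_def)

lemma transition_has_derivative:
  assumes "c \<in> charts_at A p" "c' \<in> charts_at A p"
  shows "(transition c c' has_derivative frechet_derivative (transition c c') (at (snd c p))) (at (snd c p))"
  using assms
  by (intro smooth_on_has_derivative[OF smooth_on_transition open_chart_overlap])
     (auto simp: charts_at_def)

lemma linear_transition_derivative:
  assumes "c \<in> charts_at A p" "c' \<in> charts_at A p"
  shows "linear (frechet_derivative (transition c c') (at (snd c p)))"
  using transition_has_derivative[OF assms] by (rule has_derivative_linear)

lemma transition_self_derivative:
  assumes "c \<in> charts_at A p"
  shows "frechet_derivative (transition c c) (at (snd c p)) u = u"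
proof -
  have c: "c \<in> A" "p \<in> fst c" using assms by (auto simp: charts_at_def)
  have "((\<lambda>x. x) has_derivative (\<lambda>u. u)) (at (snd c p))" by (rule has_derivative_ident)
  then have "(transition c c has_derivative (\<lambda>u. u)) (at (snd c p))"
    by (rule has_derivative_transform_within_open[OF _ open_chart_overlap[OF c(1) c(1)]])
       (use c in \<open>auto simp: transition_apply\<close>)
  from frechet_derivative_at[OF this, symmetric] show ?thesis by simp
qed

lemma transition_derivative_compose:
  assumes "c \<in> charts_at A p" "c' \<in> charts_at A p" "c'' \<in> charts_at A p"
  shows "frechet_derivative (transition c' c'') (at (snd c' p)) (frechet_derivative (transition c c') (at (snd c p)) u)
       = frechet_derivative (transition c c'') (at (snd c p)) u"
proof -
  have c: "c \<in> A" "p \<in> fst c" "c' \<in> A" "p \<in> fst c'" "c'' \<in> A" "p \<in> fst c''"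
    using assms by (auto simp: charts_at_def)
  have inj: "inj_on (snd c) (fst c)" using atlas c by (simp add: smooth_atlas_def)
  \<comment> \<open>By injectivity of the chart this is the image of the triple overlap; in this
    form its openness follows from the pairwise condition on an atlas.\<close>
  let ?O = "snd c ` (fst c \<inter> fst c') \<inter> snd c ` (fst c \<inter> fst c'')"
  have "open ?O" using open_chart_overlap c by blast
  have at: "transition c c' (snd c p) = snd c' p" using c by (simp add: transition_apply)
  have "((transition c' c'' \<circ> transition c c') has_derivative
      frechet_derivative (transition c' c'') (at (snd c' p)) \<circ> frechet_derivative (transition c c') (at (snd c p)))
      (at (snd c p))"
    using transition_has_derivative[OF assms(2,3)]
    by (intro diff_chain_at transition_has_derivative assms) (simp add: at)
  then have "(transition c c'' has_derivative
      frechet_derivative (transition c' c'') (at (snd c' p)) \<circ> frechet_derivative (transition c c') (at (snd c p)))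
      (at (snd c p))"
  proof (rule has_derivative_transform_within_open[OF _ \<open>open ?O\<close>])
    show "snd c p \<in> ?O" using c by blast
    fix x assume "x \<in> ?O"
    then obtain q where "x = snd c q" "q \<in> fst c" "q \<in> fst c'" "q \<in> fst c''"
      using inj by (auto simp: inj_on_def)
    then show "(transition c' c'' \<circ> transition c c') x = transition c c'' x"
      using c by (simp add: transition_apply)
  qed
  from frechet_derivative_at[OF this, symmetric] show ?thesis by simp
qed

lemma tangent_of_self: "c \<in> charts_at A p \<Longrightarrow> tangent_of A c p u c = u"
  by (simp add: tangent_of_def transition_self_derivative)

lemma tangent_of_in_tangent_space: "c \<in> charts_at A p \<Longrightarrow> tangent_of A c p u \<in> tangent_space A p"
  unfolding tangent_space_def tangent_of_def by (simp add: transition_derivative_compose)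

lemma tangent_space_component:
  assumes "v \<in> tangent_space A p" "c \<in> charts_at A p" "c' \<in> charts_at A p"
  shows "frechet_derivative (transition c c') (at (snd c p)) (v c) = v c'"
proof -
  have "\<forall>c\<in>charts_at A p. \<forall>c'\<in>charts_at A p.
      v c' = frechet_derivative (transition c c') (at (snd c p)) (v c)"
    using assms(1) unfolding tangent_space_def mem_Collect_eq by (rule conjunct1)
  from bspec[OF bspec[OF this assms(2)] assms(3)] show ?thesis by (rule sym)
qed

lemma tangent_of_component:
  assumes "c \<in> charts_at A p" "v \<in> tangent_space A p"
  shows "tangent_of A c p (v c) = v"
proof
  fix c'
  have "\<forall>c. c \<notin> charts_at A p \<longrightarrow> v c = 0"
    using assms(2) unfolding tangent_space_def mem_Collect_eq by (rule conjunct2)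
  then show "tangent_of A c p (v c) c' = v c'"
    using tangent_space_component[OF assms(2,1)]
    by (simp add: tangent_of_def del: split_paired_All)
qed

lemma tangent_space_eqI:
  assumes "c \<in> charts_at A p" "v \<in> tangent_space A p" "w \<in> tangent_space A p" "v c = w c"
  shows "v = w"
proof -
  have "v = tangent_of A c p (v c)" by (rule tangent_of_component[OF assms(1,2), symmetric])
  also have "\<dots> = tangent_of A c p (w c)" by (simp only: assms(4))
  also have "\<dots> = w" by (rule tangent_of_component[OF assms(1,3)])
  finally show ?thesis .
qed

lemma tangent_of_add:
  "c \<in> charts_at A p \<Longrightarrow> tangent_of A c p (u + w) = tv_add (tangent_of A c p u) (tangent_of A c p w)"
  by (auto simp: tangent_of_def tv_add_def fun_eq_iff linear_add[OF linear_transition_derivative])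

lemma tangent_of_scale:
  "c \<in> charts_at A p \<Longrightarrow> tangent_of A c p (r *\<^sub>R u) = tv_scale r (tangent_of A c p u)"
  by (auto simp: tangent_of_def tv_scale_def fun_eq_iff linear_cmul[OF linear_transition_derivative])

lemma tangent_of_zero: "c \<in> charts_at A p \<Longrightarrow> tangent_of A c p 0 = tv_zero"
  by (auto simp: tangent_of_def tv_zero_def fun_eq_iff linear_0[OF linear_transition_derivative])

lemma tangent_space_scale:
  assumes "c \<in> charts_at A p" "v \<in> tangent_space A p"
  shows "tv_scale r v \<in> tangent_space A p"
  using tangent_of_in_tangent_space[OF assms(1), of "r *\<^sub>R v c"]
  by (simp add: tangent_of_scale[OF assms(1)] tangent_of_component[OF assms])

lemma component_eq_0_iff:
  assumes "c \<in> charts_at A p" "v \<in> tangent_space A p"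
  shows "v c = 0 \<longleftrightarrow> v = tv_zero"
proof
  assume "v c = 0"
  then have "tangent_of A c p 0 = v" using tangent_of_component[OF assms] by (simp only:)
  then show "v = tv_zero" by (simp add: tangent_of_zero[OF assms(1)])
qed (simp add: tv_zero_def)

lemma openin_chart_image:
  assumes "openin (manifold_topology A) W" "c \<in> A"
  shows "open (snd c ` (W \<inter> fst c))"
  using assms openin_manifold_topology[OF atlas] by blast

lemma openin_chart_domain: "c \<in> A \<Longrightarrow> openin (manifold_topology A) (fst c)"
  using open_chart_overlap
  by (auto simp: openin_manifold_topology[OF atlas] points_def Int_commute)

lemma openin_points: "openin (manifold_topology A) (points A)"
proof -
  have "points A \<inter> fst c = fst c \<inter> fst c" if "c \<in> A" for c using that by (auto simp: points_def)
  then have "open (snd c ` (points A \<inter> fst c))" if "c \<in> A" for c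
    using open_chart_overlap[OF that that] that by simp
  then show ?thesis by (simp add: openin_manifold_topology[OF atlas])
qed

text \<open>In any other chart the components are the Jacobian of the transition applied to the
  components in \<open>c\<close>, with base point and argument both moving; hence
  \<open>smooth_on_derivative_compose\<close>.\<close>

lemma smooth_vector_field_local:
  assumes "c \<in> A" and W: "openin (manifold_topology A) W" "W \<subseteq> fst c"
    and Z: "\<And>p. p \<in> W \<Longrightarrow> Z p \<in> tangent_space A p"
    and smooth: "smooth_on (snd c ` W) (\<lambda>x. Z (chart_inv c x) c)"
  shows "smooth_vector_field A W Z"
  unfolding smooth_vector_field_def
proof (intro conjI ballI Z)
  fix c' assume "c' \<in> A"
  let ?S = "snd c' ` (W \<inter> fst c')"
  have opS: "open ?S" using openin_chart_image[OF W(1) \<open>c' \<in> A\<close>] .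
  have WC: "W \<inter> fst c = W" using W by blast
  have opW: "open (snd c ` W)" using openin_chart_image[OF W(1) \<open>c \<in> A\<close>] WC by simp
  have tr: "smooth_on ?S (transition c' c)"
    by (rule smooth_on_subset[OF smooth_on_transition[OF \<open>c' \<in> A\<close> \<open>c \<in> A\<close>]]) (use W in auto)
  have "smooth_on ?S (\<lambda>x. frechet_derivative (transition c c') (at (transition c' c x))
      (Z (chart_inv c (transition c' c x)) c))"
  proof (rule smooth_on_derivative_compose[OF opS open_chart_overlap[OF \<open>c \<in> A\<close> \<open>c' \<in> A\<close>] _ tr smooth_on_transition[OF \<open>c \<in> A\<close> \<open>c' \<in> A\<close>]])
    show "transition c' c ` ?S \<subseteq> snd c ` (fst c \<inter> fst c')"
      using \<open>c' \<in> A\<close> W by (auto simp: transition_apply)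
    show "smooth_on ?S (\<lambda>x. Z (chart_inv c (transition c' c x)) c)"
      by (rule smooth_on_compose[OF opS opW _ tr smooth])
         (use \<open>c' \<in> A\<close> W in \<open>auto simp: transition_apply\<close>)
  qed
  moreover have "frechet_derivative (transition c c') (at (transition c' c x))
      (Z (chart_inv c (transition c' c x)) c) = Z (chart_inv c' x) c'" if x: "x \<in> ?S" for x
  proof -
    obtain p where p: "x = snd c' p" "p \<in> W" "p \<in> fst c'" using x by blast
    then have "p \<in> fst c" using W by blast
    then show ?thesis
      using tangent_space_component[OF Z[OF p(2)], of c c'] p \<open>c \<in> A\<close> \<open>c' \<in> A\<close>
      by (simp add: transition_apply chart_inv_apply charts_at_def)
  qed
  ultimately show "smooth_on ?S (\<lambda>x. Z (chart_inv c' x) c')"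
    using smooth_on_cong[OF opS] by (metis (no_types, lifting))
qed

lemma smooth_fun_local:
  assumes "c \<in> A" and W: "openin (manifold_topology A) W" "W \<subseteq> fst c"
    and smooth: "smooth_on (snd c ` W) (f \<circ> chart_inv c)"
  shows "smooth_fun A W f"
  unfolding smooth_fun_def
proof
  fix c' assume "c' \<in> A"
  let ?S = "snd c' ` (W \<inter> fst c')"
  have opS: "open ?S" using openin_chart_image[OF W(1) \<open>c' \<in> A\<close>] .
  have WC: "W \<inter> fst c = W" using W by blast
  have opW: "open (snd c ` W)" using openin_chart_image[OF W(1) \<open>c \<in> A\<close>] WC by simp
  have tr: "smooth_on ?S (transition c' c)"
    by (rule smooth_on_subset[OF smooth_on_transition[OF \<open>c' \<in> A\<close> \<open>c \<in> A\<close>]]) (use W in auto)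
  have "smooth_on ?S (\<lambda>x. (f \<circ> chart_inv c) (transition c' c x))"
    by (rule smooth_on_compose[OF opS opW _ tr smooth])
       (use \<open>c' \<in> A\<close> W in \<open>auto simp: transition_apply\<close>)
  moreover have "(f \<circ> chart_inv c) (transition c' c x) = (f \<circ> chart_inv c') x" if "x \<in> ?S" for x
    using that W \<open>c \<in> A\<close> \<open>c' \<in> A\<close> by (auto simp: transition_apply chart_inv_apply)
  ultimately show "smooth_on ?S (f \<circ> chart_inv c')"
    using smooth_on_cong[OF opS] by (metis (no_types, lifting))
qed

end

text \<open>\<phi> is linear on the tangent space only, which is a set of functions on charts;
  \<open>tangent_of\<close> transports it to a genuine linear map on coordinates.\<close>

lemma tangent_functional_expansion:
  fixes A :: "('m, real^'n) chart set" and \<phi> :: "('m, real^'n) tvec \<Rightarrow> real"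
  assumes "smooth_atlas A" "c \<in> charts_at A p" "v \<in> tangent_space A p"
    and add: "\<And>u w. u \<in> tangent_space A p \<Longrightarrow> w \<in> tangent_space A p \<Longrightarrow> \<phi> (tv_add u w) = \<phi> u + \<phi> w"
    and scale: "\<And>r u. u \<in> tangent_space A p \<Longrightarrow> \<phi> (tv_scale r u) = r * \<phi> u"
  shows "\<phi> v = (\<Sum>a\<in>UNIV. v c $ a * \<phi> (tangent_of A c p (axis a 1)))"
proof -
  define \<psi> where "\<psi> u = \<phi> (tangent_of A c p u)" for u
  note T = tangent_of_in_tangent_space[OF assms(1,2)]
  have lin: "linear \<psi>"
    by (rule linearI)
       (simp_all add: \<psi>_def tangent_of_add[OF assms(1,2)] tangent_of_scale[OF assms(1,2)] add scale T)
  have "\<phi> v = \<psi> (v c)" by (simp add: \<psi>_def tangent_of_component[OF assms(1-3)])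
  also have "\<dots> = \<psi> (\<Sum>a\<in>UNIV. v c $ a *\<^sub>R axis a 1)"
    using basis_expansion[of "v c"] by (simp add: scalar_mult_eq_scaleR)
  also have "\<dots> = (\<Sum>a\<in>UNIV. v c $ a * \<psi> (axis a 1))"
    unfolding linear_sum[OF lin] linear_cmul[OF lin] by simp
  finally show ?thesis by (simp add: \<psi>_def)
qed

section \<open>The atlas of the slit bundle and sections of the pullback bundle\<close>

context
  fixes A :: "('m, real^'n) chart set"
  assumes atlas: "smooth_atlas A"
begin

lemma fst_bundle_chart: "fst (bundle_chart A c) = {X \<in> slit_bundle A. fst X \<in> fst c}"
  and snd_bundle_chart: "snd (bundle_chart A c) X = (snd c (fst X), snd X c)"
  by (simp_all add: bundle_chart_def)

lemma bundle_chart_in_slit_atlas: "c \<in> A \<Longrightarrow> bundle_chart A c \<in> slit_atlas A"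
  by (simp add: slit_atlas_def)

lemma slit_bundle_tangent: "X \<in> slit_bundle A \<Longrightarrow> snd X \<in> tangent_space A (fst X)"
  by (auto simp: slit_bundle_def)

text \<open>A tangent vector vanishes exactly when its components in one chart do, so the zero
  section corresponds to y = 0. With \<open>U\<close> a chart domain or an overlap, this provides
  the open sets required of the induced charts.\<close>

lemma bundle_chart_image:
  assumes "c \<in> A" "U \<subseteq> fst c"
  shows "snd (bundle_chart A c) ` {X \<in> slit_bundle A. fst X \<in> U} = snd c ` U \<times> - {0}"
proof (intro equalityI subsetI)
  fix z assume "z \<in> snd (bundle_chart A c) ` {X \<in> slit_bundle A. fst X \<in> U}"
  then obtain X where X: "X \<in> slit_bundle A" "fst X \<in> U" "z = (snd c (fst X), snd X c)"
    by (auto simp: snd_bundle_chart)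
  have "c \<in> charts_at A (fst X)" using X assms by (auto simp: charts_at_def)
  then have "snd X c \<noteq> 0"
    using X component_eq_0_iff[OF atlas] by (fastforce simp: slit_bundle_def)
  then show "z \<in> snd c ` U \<times> - {0}" using X by auto
next
  fix z :: "(real^'n) \<times> (real^'n)"
  assume "z \<in> snd c ` U \<times> - {0}"
  then have "fst z \<in> snd c ` U" "snd z \<noteq> 0" by (auto simp: mem_Times_iff)
  then obtain p where p: "p \<in> U" "fst z = snd c p" "snd z \<noteq> 0" by blast
  have c: "c \<in> charts_at A p" using p assms by (auto simp: charts_at_def)
  let ?X = "(p, tangent_of A c p (snd z))"
  have "tangent_of A c p (snd z) \<noteq> tv_zero"
    using tangent_of_self[OF atlas c, of "snd z"] p by (auto simp: tv_zero_def)
  then have 1: "?X \<in> {X \<in> slit_bundle A. fst X \<in> U}"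
    using p c tangent_of_in_tangent_space[OF atlas c]
    by (auto simp: slit_bundle_def points_def charts_at_def)
  have "z = snd (bundle_chart A c) ?X"
    using p tangent_of_self[OF atlas c] by (simp add: snd_bundle_chart prod_eq_iff)
  then show "z \<in> snd (bundle_chart A c) ` {X \<in> slit_bundle A. fst X \<in> U}"
    using 1 by (rule image_eqI)
qed

lemma coord_domain_eq: "c \<in> A \<Longrightarrow> coord_domain A c = snd c ` fst c \<times> - {0}"
  unfolding coord_domain_def fst_bundle_chart by (rule bundle_chart_image) auto

lemma open_coord_domain: "c \<in> A \<Longrightarrow> open (coord_domain A c)"
  using open_chart_overlap[OF atlas, of c c] by (simp add: coord_domain_eq open_Times open_Compl)

lemma inj_on_bundle_chart:
  assumes "c \<in> A"
  shows "inj_on (snd (bundle_chart A c)) (fst (bundle_chart A c))"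
proof (rule inj_onI)
  fix X Y assume XY: "X \<in> fst (bundle_chart A c)" "Y \<in> fst (bundle_chart A c)"
    and eq: "snd (bundle_chart A c) X = snd (bundle_chart A c) Y"
  have "inj_on (snd c) (fst c)" using atlas assms by (simp add: smooth_atlas_def)
  then have f: "fst X = fst Y" using XY eq by (auto simp: fst_bundle_chart snd_bundle_chart inj_on_def)
  have "c \<in> charts_at A (fst X)" using XY assms by (auto simp: fst_bundle_chart charts_at_def)
  then have "snd X = snd Y"
    by (rule tangent_space_eqI[OF atlas])
       (use XY eq f in \<open>auto simp: fst_bundle_chart snd_bundle_chart slit_bundle_def\<close>)
  with f show "X = Y" by (simp add: prod_eq_iff)
qed

text \<open>The induced transition is (x, y) \<mapsto> (\<tau> x, D\<tau>(x) y) for the base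
  transition \<tau>. The second component is the case of \<open>smooth_on_derivative_compose\<close>
  in which base point and argument are the two projections.\<close>

lemma smooth_atlas_slit: "smooth_atlas (slit_atlas A)"
  unfolding smooth_atlas_def
proof (intro conjI ballI)
  fix b assume "b \<in> slit_atlas A"
  then show "inj_on (snd b) (fst b)" using inj_on_bundle_chart by (auto simp: slit_atlas_def)
next
  fix b b' assume "b \<in> slit_atlas A" "b' \<in> slit_atlas A"
  then obtain c c' where c: "c \<in> A" "b = bundle_chart A c" "c' \<in> A" "b' = bundle_chart A c'"
    by (auto simp: slit_atlas_def)
  let ?U = "snd c ` (fst c \<inter> fst c')"
  have "fst b \<inter> fst b' = {X \<in> slit_bundle A. fst X \<in> fst c \<inter> fst c'}"
    using c by (auto simp: fst_bundle_chart)
  then have im: "snd b ` (fst b \<inter> fst b') = ?U \<times> - {0}"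
    using bundle_chart_image[of c "fst c \<inter> fst c'"] c by simp
  have opU: "open ?U" using open_chart_overlap[OF atlas] c by blast
  then show op: "open (snd b ` (fst b \<inter> fst b'))" unfolding im by (simp add: open_Times open_Compl)
  have tr: "smooth_on ?U (transition c c')" using smooth_on_transition[OF atlas] c by blast
  let ?S = "?U \<times> - {0 :: real^'n}"
  have opS: "open ?S" using op im by simp
  have "smooth_on ?S (\<lambda>z. (transition c c' (fst z), frechet_derivative (transition c c') (at (fst z)) (snd z)))"
  proof (intro smooth_on_Pair opS)
    show "smooth_on ?S (\<lambda>z. transition c c' (fst z))"
      by (rule smooth_on_compose[OF opS opU _ smooth_on_bounded_linear[OF bounded_linear_fst] tr]) auto
    show "smooth_on ?S (\<lambda>z. frechet_derivative (transition c c') (at (fst z)) (snd z))"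
      by (rule smooth_on_derivative_compose[OF opS opU _ smooth_on_bounded_linear[OF bounded_linear_fst]
            tr smooth_on_bounded_linear[OF bounded_linear_snd]]) auto
  qed
  moreover have "(transition c c' (fst z), frechet_derivative (transition c c') (at (fst z)) (snd z))
      = transition b b' z" if z: "z \<in> ?S" for z
  proof -
    obtain X where X: "X \<in> fst b" "X \<in> fst b'" "z = snd b X" using z unfolding im[symmetric] by blast
    have "chart_inv b z = X"
      using X inj_on_bundle_chart c by (simp add: chart_inv_def inv_into_f_f)
    then have "transition b b' z = (snd c' (fst X), snd X c')"
      using c by (simp add: transition_def snd_bundle_chart)
    moreover have "snd X \<in> tangent_space A (fst X)" "c \<in> charts_at A (fst X)" "c' \<in> charts_at A (fst X)"
      using X c by (auto simp: fst_bundle_chart charts_at_def slit_bundle_tangent)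
    ultimately show ?thesis using X c tangent_space_component[OF atlas]
      by (auto simp: snd_bundle_chart transition_apply[OF atlas] charts_at_def)
  qed
  ultimately show "smooth_on (snd b ` (fst b \<inter> fst b')) (transition b b')"
    unfolding im using smooth_on_cong[OF opS] by (metis (no_types, lifting))
qed

lemma chart_inv_bundle_chart:
  "c \<in> A \<Longrightarrow> X \<in> fst (bundle_chart A c) \<Longrightarrow> chart_inv (bundle_chart A c) (snd (bundle_chart A c) X) = X"
  by (rule chart_inv_apply[OF smooth_atlas_slit bundle_chart_in_slit_atlas])

lemma points_slit_atlas: "points (slit_atlas A) = slit_bundle A"
  by (auto simp: points_def slit_atlas_def fst_bundle_chart) (auto simp: slit_bundle_def points_def)

lemma openin_slit_bundle: "openin (slit_topology A) (slit_bundle A)"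
  using openin_points[OF smooth_atlas_slit] by (simp add: points_slit_atlas)

lemma openin_bundle_domain: "c \<in> A \<Longrightarrow> openin (slit_topology A) (fst (bundle_chart A c))"
  by (rule openin_chart_domain[OF smooth_atlas_slit bundle_chart_in_slit_atlas])

lemma charts_at_bundle_chart:
  assumes "c \<in> A" "X \<in> fst (bundle_chart A c)"
  shows "c \<in> charts_at A (fst X)" "bundle_chart A c \<in> charts_at (slit_atlas A) X"
  using assms by (auto simp: charts_at_def fst_bundle_chart slit_atlas_def)

lemma smooth_section_subset:
  assumes "smooth_section A W s" "W' \<subseteq> W"
  shows "smooth_section A W' s"
  unfolding smooth_section_def
proof (intro conjI ballI)
  fix X assume "X \<in> W'"
  then show "s X \<in> tangent_space A (fst X)" using assms by (auto simp: smooth_section_def)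
next
  fix c assume "c \<in> A"
  then have "smooth_on (snd (bundle_chart A c) ` (W \<inter> fst (bundle_chart A c)))
                      (\<lambda>z. s (chart_inv (bundle_chart A c) z) c)"
    using assms by (simp add: smooth_section_def)
  then show "smooth_on (snd (bundle_chart A c) ` (W' \<inter> fst (bundle_chart A c)))
                      (\<lambda>z. s (chart_inv (bundle_chart A c) z) c)"
    by (rule smooth_on_subset) (use assms in blast)
qed

text \<open>As for vector fields, with one difference: the components change by the Jacobian of the
  transition of the base, while the argument changes by the transition of the slit bundle.\<close>

lemma smooth_section_local:
  assumes "c \<in> A" and W: "openin (slit_topology A) W" "W \<subseteq> fst (bundle_chart A c)"
    and s: "\<And>X. X \<in> W \<Longrightarrow> s X \<in> tangent_space A (fst X)"
    and smooth: "smooth_on (snd (bundle_chart A c) ` W) (\<lambda>z. s (chart_inv (bundle_chart A c) z) c)"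
  shows "smooth_section A W s"
  unfolding smooth_section_def
proof (intro conjI ballI s)
  fix c' assume "c' \<in> A"
  let ?b = "bundle_chart A c" and ?b' = "bundle_chart A c'"
  note b = bundle_chart_in_slit_atlas[OF \<open>c \<in> A\<close>] and b' = bundle_chart_in_slit_atlas[OF \<open>c' \<in> A\<close>]
  note slit = smooth_atlas_slit
  let ?S = "snd ?b' ` (W \<inter> fst ?b')"
  have opS: "open ?S" using openin_chart_image[OF slit W(1) b'] .
  have WC: "W \<inter> fst ?b = W" using W by blast
  have opW: "open (snd ?b ` W)" using openin_chart_image[OF slit W(1) b] WC by simp
  have tr: "smooth_on ?S (transition ?b' ?b)"
    by (rule smooth_on_subset[OF smooth_on_transition[OF slit b' b]]) (use W in auto)
  have fstS: "fst ` ?S \<subseteq> snd c' ` (fst c' \<inter> fst c)"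
    using W by (force simp: fst_bundle_chart snd_bundle_chart)
  have trc: "smooth_on ?S (\<lambda>z. transition c' c (fst z))"
    by (rule smooth_on_compose[OF opS open_chart_overlap[OF atlas \<open>c' \<in> A\<close> \<open>c \<in> A\<close>] fstS
          smooth_on_bounded_linear[OF bounded_linear_fst]
          smooth_on_transition[OF atlas \<open>c' \<in> A\<close> \<open>c \<in> A\<close>]])
  have "smooth_on ?S (\<lambda>z. frechet_derivative (transition c c') (at (transition c' c (fst z)))
      (s (chart_inv ?b (transition ?b' ?b z)) c))"
  proof (rule smooth_on_derivative_compose[OF opS open_chart_overlap[OF atlas \<open>c \<in> A\<close> \<open>c' \<in> A\<close>] _ trc
        smooth_on_transition[OF atlas \<open>c \<in> A\<close> \<open>c' \<in> A\<close>]])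
    show "(\<lambda>z. transition c' c (fst z)) ` ?S \<subseteq> snd c ` (fst c \<inter> fst c')"
      using fstS \<open>c' \<in> A\<close> by (force simp: transition_apply[OF atlas] dest!: subsetD[OF fstS, OF imageI])
    show "smooth_on ?S (\<lambda>z. s (chart_inv ?b (transition ?b' ?b z)) c)"
      by (rule smooth_on_compose[OF opS opW _ tr smooth])
         (use W in \<open>auto simp: transition_apply[OF slit b']\<close>)
  qed
  moreover have "frechet_derivative (transition c c') (at (transition c' c (fst z)))
      (s (chart_inv ?b (transition ?b' ?b z)) c) = s (chart_inv ?b' z) c'" if z: "z \<in> ?S" for z
  proof -
    obtain X where X: "z = snd ?b' X" "X \<in> W" "X \<in> fst ?b'" using z by blast
    then have "X \<in> fst ?b" using W by blast
    then have "c \<in> charts_at A (fst X)" "c' \<in> charts_at A (fst X)"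
      using charts_at_bundle_chart X \<open>c \<in> A\<close> \<open>c' \<in> A\<close> by blast+
    then have "frechet_derivative (transition c c') (at (snd c (fst X))) (s X c) = s X c'"
      using tangent_space_component[OF atlas s[OF X(2)]] by blast
    moreover have "transition c' c (fst z) = snd c (fst X)"
      using X \<open>c' \<in> A\<close> \<open>c' \<in> charts_at A (fst X)\<close>
      by (simp add: transition_apply[OF atlas] snd_bundle_chart charts_at_def)
    ultimately show ?thesis
      using X \<open>X \<in> fst ?b\<close> by (simp add: transition_apply[OF slit b'] chart_inv_bundle_chart \<open>c \<in> A\<close> \<open>c' \<in> A\<close>)
  qed
  ultimately show "smooth_on ?S (\<lambda>z. s (chart_inv ?b' z) c')"
    using smooth_on_cong[OF opS] by (metis (no_types, lifting))
qed

lemma smooth_section_tangent_of: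
  assumes "c \<in> A" and W: "openin (slit_topology A) W" "W \<subseteq> fst (bundle_chart A c)"
    and smooth: "smooth_on (snd (bundle_chart A c) ` W) (\<lambda>z. f (chart_inv (bundle_chart A c) z))"
  shows "smooth_section A W (\<lambda>X. tangent_of A c (fst X) (f X))"
proof (rule smooth_section_local[OF assms(1) W])
  have c: "c \<in> charts_at A (fst X)" if "X \<in> W" for X
    using that W charts_at_bundle_chart assms by blast
  then show "tangent_of A c (fst X) (f X) \<in> tangent_space A (fst X)" if "X \<in> W" for X
    using that tangent_of_in_tangent_space[OF atlas] by blast
  have "W \<inter> fst (bundle_chart A c) = W" using W by blast
  then have op: "open (snd (bundle_chart A c) ` W)"
    using openin_chart_image[OF smooth_atlas_slit W(1) bundle_chart_in_slit_atlas[OF assms(1)]] by simp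
  have "tangent_of A c (fst (chart_inv (bundle_chart A c) z)) (f (chart_inv (bundle_chart A c) z)) c
      = f (chart_inv (bundle_chart A c) z)" if z: "z \<in> snd (bundle_chart A c) ` W" for z
  proof -
    obtain X where X: "X \<in> W" "z = snd (bundle_chart A c) X" using z by blast
    then have "chart_inv (bundle_chart A c) z = X" using chart_inv_bundle_chart assms(1) W by blast
    then show ?thesis using tangent_of_self[OF atlas c[OF X(1)]] by simp
  qed
  then show "smooth_on (snd (bundle_chart A c) ` W)
     (\<lambda>z. tangent_of A c (fst (chart_inv (bundle_chart A c) z)) (f (chart_inv (bundle_chart A c) z)) c)"
    using smooth smooth_on_cong[OF op] by (metis (no_types, lifting))
qed

lemma smooth_section_frame:
  assumes "c \<in> A" "openin (slit_topology A) W" "W \<subseteq> fst (bundle_chart A c)"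
  shows "smooth_section A W (frame A c a)"
  unfolding frame_def[abs_def] using assms
  by (intro smooth_section_tangent_of smooth_on_const)

text \<open>The field with constant components u; inserting it into a connection makes the
  connection forms smooth for every fixed u.\<close>

lemma smooth_coordinate_field:
  assumes "c \<in> A"
  shows "smooth_vector_field (slit_atlas A) (fst (bundle_chart A c))
           (\<lambda>X. tangent_of (slit_atlas A) (bundle_chart A c) X u)"
proof (rule smooth_vector_field_local[OF smooth_atlas_slit bundle_chart_in_slit_atlas[OF assms]
      openin_bundle_domain[OF assms] order_refl])
  let ?b = "bundle_chart A c"
  show "tangent_of (slit_atlas A) ?b X u \<in> tangent_space (slit_atlas A) X" if "X \<in> fst ?b" for X
    using tangent_of_in_tangent_space[OF smooth_atlas_slit] charts_at_bundle_chart(2)[OF assms that] by blast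
  have op: "open (snd ?b ` fst ?b)" using open_coord_domain[OF assms] by (simp add: coord_domain_def)
  have "tangent_of (slit_atlas A) ?b (chart_inv ?b z) u ?b = u" if z: "z \<in> snd ?b ` fst ?b" for z
  proof -
    obtain X where X: "X \<in> fst ?b" "z = snd ?b X" using z by blast
    show ?thesis
      unfolding X(2) chart_inv_bundle_chart[OF assms X(1)]
      by (rule tangent_of_self[OF smooth_atlas_slit charts_at_bundle_chart(2)[OF assms X(1)]])
  qed
  then show "smooth_on (snd ?b ` fst ?b) (\<lambda>z. tangent_of (slit_atlas A) ?b (chart_inv ?b z) u ?b)"
    using smooth_on_const smooth_on_cong[OF op] by (metis (no_types, lifting))
qed

lemma smooth_section_liouville: "smooth_section A (slit_bundle A) liouville"
  unfolding smooth_section_def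
proof (intro conjI ballI)
  fix X assume "X \<in> slit_bundle A"
  then show "liouville X \<in> tangent_space A (fst X)" by (simp add: liouville_def slit_bundle_tangent)
next
  fix c assume "c \<in> A"
  let ?b = "bundle_chart A c"
  have eq: "slit_bundle A \<inter> fst ?b = fst ?b" by (auto simp: fst_bundle_chart)
  have op: "open (snd ?b ` fst ?b)" using open_coord_domain[OF \<open>c \<in> A\<close>] by (simp add: coord_domain_def)
  have "liouville (chart_inv ?b z) c = snd z" if z: "z \<in> snd ?b ` fst ?b" for z
  proof -
    obtain X where X: "X \<in> fst ?b" "z = snd ?b X" using z by blast
    show ?thesis
      unfolding X(2) chart_inv_bundle_chart[OF \<open>c \<in> A\<close> X(1)]
      by (simp add: liouville_def snd_bundle_chart)
  qed
  then show "smooth_on (snd ?b ` (slit_bundle A \<inter> fst ?b)) (\<lambda>z. liouville (chart_inv ?b z) c)"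
    unfolding eq using smooth_on_bounded_linear[OF bounded_linear_snd] smooth_on_cong[OF op]
    by (metis (no_types, lifting))
qed

section \<open>Components of a metric\<close>

lemma coord_domainE:
  assumes "c \<in> A" "z \<in> coord_domain A c"
  obtains X where "X \<in> fst (bundle_chart A c)" "chart_inv (bundle_chart A c) z = X"
    "z = (snd c (fst X), snd X c)" "c \<in> charts_at A (fst X)" "X \<in> slit_bundle A"
proof -
  obtain X where X: "X \<in> fst (bundle_chart A c)" "z = snd (bundle_chart A c) X"
    using assms(2) by (auto simp: coord_domain_def)
  then show ?thesis using that[of X] chart_inv_bundle_chart[OF assms(1) X(1)]
    charts_at_bundle_chart(1)[OF assms(1) X(1)] by (auto simp: fst_bundle_chart snd_bundle_chart)
qed

lemma metric_expansion:
  assumes g: "is_metric A g" and X: "X \<in> slit_bundle A" and c: "c \<in> charts_at A (fst X)"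
    and uv: "u \<in> tangent_space A (fst X)" "v \<in> tangent_space A (fst X)"
  shows "g X u v = (\<Sum>a\<in>UNIV. \<Sum>b\<in>UNIV. u c $ a * v c $ b * g X (frame A c a X) (frame A c b X))"
proof -
  let ?T = "tangent_space A (fst X)"
  have sym: "\<And>u v. u \<in> ?T \<Longrightarrow> v \<in> ?T \<Longrightarrow> g X u v = g X v u"
    and add: "\<And>u v w. u \<in> ?T \<Longrightarrow> v \<in> ?T \<Longrightarrow> w \<in> ?T \<Longrightarrow> g X (tv_add u v) w = g X u w + g X v w"
    and scale: "\<And>r u w. u \<in> ?T \<Longrightarrow> w \<in> ?T \<Longrightarrow> g X (tv_scale r u) w = r * g X u w"
    using g X by (simp_all add: is_metric_def Let_def)
  have e: "g X u w = (\<Sum>a\<in>UNIV. u c $ a * g X (frame A c a X) w)" if "u \<in> ?T" "w \<in> ?T" for u w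
    unfolding frame_def
    by (rule tangent_functional_expansion[OF atlas c that(1), where \<phi> = "\<lambda>u. g X u w"])
       (use that add scale in auto)
  have f: "frame A c a X \<in> ?T" for a
    using tangent_of_in_tangent_space[OF atlas c] by (simp add: frame_def)
  \<comment> \<open>\<open>is_metric\<close> states linearity in the first argument; symmetry
    carries it to the second.\<close>
  have "g X u v = (\<Sum>a\<in>UNIV. u c $ a * g X v (frame A c a X))"
    using e[OF uv] sym f uv by simp
  also have "\<dots> = (\<Sum>a\<in>UNIV. u c $ a * (\<Sum>b\<in>UNIV. v c $ b * g X (frame A c a X) (frame A c b X)))"
    using e[OF uv(2) f] sym f by simp
  finally show ?thesis by (simp add: sum_distrib_left mult.assoc)
qed

lemma metric_comp_sym:
  assumes g: "is_metric A g" and "c \<in> A" "z \<in> coord_domain A c"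
  shows "metric_comp A g c a b z = metric_comp A g c b a z"
proof -
  obtain X where X: "chart_inv (bundle_chart A c) z = X" "c \<in> charts_at A (fst X)" "X \<in> slit_bundle A"
    using coord_domainE[OF assms(2,3)] by blast
  then show ?thesis using g tangent_of_in_tangent_space[OF atlas X(2)]
    by (simp add: metric_comp_def in_coords_def is_metric_def Let_def frame_def)
qed

text \<open>A vector in the kernel of the matrix gives a tangent vector orthogonal to the whole
  tangent space, which is zero by non-degeneracy.\<close>

lemma invertible_metric_comp:
  assumes g: "is_metric A g" and "c \<in> A" "z \<in> coord_domain A c"
  shows "invertible (\<chi> i j. metric_comp A g c i j z)" (is "invertible ?M")
proof -
  obtain X where X: "chart_inv (bundle_chart A c) z = X" "c \<in> charts_at A (fst X)" "X \<in> slit_bundle A"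
    using coord_domainE[OF assms(2,3)] by blast
  have "u = 0" if u: "?M *v u = 0" for u
  proof -
    let ?u = "tangent_of A c (fst X) u"
    have uT: "?u \<in> tangent_space A (fst X)" by (rule tangent_of_in_tangent_space[OF atlas X(2)])
    have row: "(\<Sum>b\<in>UNIV. g X (frame A c a X) (frame A c b X) * u $ b) = 0" for a
      using u by (simp add: vec_eq_iff matrix_vector_mult_def metric_comp_def in_coords_def X)
    have "g X ?u w = 0" if "w \<in> tangent_space A (fst X)" for w
    proof -
      have "g X ?u w = g X w ?u" using g X uT that by (simp add: is_metric_def Let_def)
      also have "\<dots> = (\<Sum>a\<in>UNIV. w c $ a * (\<Sum>b\<in>UNIV. g X (frame A c a X) (frame A c b X) * u $ b))"
        using metric_expansion[OF g X(3,2) that uT] tangent_of_self[OF atlas X(2), of u]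
        by (simp add: sum_distrib_left mult_ac)
      finally show ?thesis by (simp add: row)
    qed
    then have "?u = tv_zero" using g X uT by (simp add: is_metric_def Let_def)
    then show "u = 0" using tangent_of_self[OF atlas X(2), of u] by (simp add: tv_zero_def)
  qed
  then show ?thesis by (simp add: invertible_left_inverse matrix_left_invertible_ker)
qed

lemma smooth_on_metric_comp:
  assumes g: "is_metric A g" and "c \<in> A"
  shows "smooth_on (coord_domain A c) (metric_comp A g c a b)"
proof -
  let ?b = "bundle_chart A c"
  have "smooth_fun (slit_atlas A) (fst ?b) (\<lambda>X. g X (frame A c a X) (frame A c b X))"
    using g openin_bundle_domain[OF assms(2)] smooth_section_frame[OF assms(2)]
    unfolding is_metric_def by blast
  then have "smooth_on (snd ?b ` (fst ?b \<inter> fst ?b)) ((\<lambda>X. g X (frame A c a X) (frame A c b X)) \<circ> chart_inv ?b)"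
    using bundle_chart_in_slit_atlas[OF assms(2)] unfolding smooth_fun_def by blast
  then show ?thesis
    by (simp add: coord_domain_def metric_comp_def[abs_def] in_coords_def[abs_def] o_def)
qed

end

section \<open>Finsler connections\<close>

lemma
  assumes "finsler_connection A nabla" "openin (slit_topology A) W" "smooth_section A W s"
    "X \<in> W" "Z \<in> tangent_space (slit_atlas A) X"
  shows finsler_in_tangent_space: "nabla s X Z \<in> tangent_space A (fst X)"
    and finsler_cong: "\<And>t. smooth_section A W t \<Longrightarrow> (\<And>Y. Y \<in> W \<Longrightarrow> s Y = t Y) \<Longrightarrow> nabla s X Z = nabla t X Z"
    and finsler_add: "\<And>t. smooth_section A W t \<Longrightarrow>
      nabla (\<lambda>Y. tv_add (s Y) (t Y)) X Z = tv_add (nabla s X Z) (nabla t X Z)"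
    and finsler_leibniz: "\<And>f. smooth_fun (slit_atlas A) W f \<Longrightarrow>
      nabla (\<lambda>Y. tv_scale (f Y) (s Y)) X Z =
        tv_add (tv_scale (differential (slit_atlas A) f X Z) (s X)) (tv_scale (f X) (nabla s X Z))"
  using assms(1)[unfolded finsler_connection_def Let_def, rule_format, OF conjI[OF assms(2,3)],
      THEN conjunct1, rule_format, OF assms(4)] assms(5)
  by blast+

lemma finsler_smooth:
  assumes "finsler_connection A nabla" "openin (slit_topology A) W" "smooth_section A W s"
    "smooth_vector_field (slit_atlas A) W Z"
  shows "smooth_section A W (\<lambda>X. nabla s X (Z X))"
  using assms(1)[unfolded finsler_connection_def, rule_format, OF conjI[OF assms(2,3)], THEN conjunct2] assms(4)
  by blast

section \<open>Connections are determined by their connection forms\<close>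

context
  fixes A :: "('m, real^'n) chart set"
  assumes atlas: "smooth_atlas A"
begin

lemma smooth_section_cong:
  assumes W: "openin (slit_topology A) W" and s: "smooth_section A W s"
    and eq: "\<And>Y. Y \<in> W \<Longrightarrow> s Y = t Y"
  shows "smooth_section A W t"
  unfolding smooth_section_def
proof (intro conjI ballI)
  show "t X \<in> tangent_space A (fst X)" if "X \<in> W" for X
    using s[unfolded smooth_section_def, THEN conjunct1, rule_format, OF that] eq[OF that] by simp
next
  fix c assume c: "c \<in> A"
  let ?b = "bundle_chart A c"
  let ?S = "snd ?b ` (W \<inter> fst ?b)"
  have op: "open ?S"
    by (rule openin_chart_image[OF smooth_atlas_slit[OF atlas] W bundle_chart_in_slit_atlas[OF atlas c]])
  have "s (chart_inv ?b z) c = t (chart_inv ?b z) c" if z: "z \<in> ?S" for z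
  proof -
    obtain X where X: "X \<in> W" "X \<in> fst ?b" "z = snd ?b X" using z by blast
    show ?thesis unfolding X(3) chart_inv_bundle_chart[OF atlas c X(2)] eq[OF X(1)] ..
  qed
  moreover have "smooth_on ?S (\<lambda>z. s (chart_inv ?b z) c)"
    using s c by (simp add: smooth_section_def)
  ultimately show "smooth_on ?S (\<lambda>z. t (chart_inv ?b z) c)"
    using smooth_on_cong[OF op, of "\<lambda>z. s (chart_inv ?b z) c" "\<lambda>z. t (chart_inv ?b z) c"] by simp
qed

lemma smooth_on_conn_form:
  assumes "finsler_connection A nabla" "c \<in> A"
  shows "smooth_on (coord_domain A c) (\<lambda>z. conn_form A nabla c a b z u)"
proof -
  let ?b = "bundle_chart A c"
  let ?Z = "\<lambda>X. tangent_of (slit_atlas A) ?b X u"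
  have "smooth_section A (fst ?b) (\<lambda>X. nabla (frame A c b) X (?Z X))"
    by (rule finsler_smooth[OF assms(1) openin_bundle_domain[OF atlas assms(2)]
          smooth_section_frame[OF atlas assms(2) openin_bundle_domain[OF atlas assms(2)] order_refl]
          smooth_coordinate_field[OF atlas assms(2)]])
  then have "smooth_on (snd ?b ` (fst ?b \<inter> fst ?b))
      (\<lambda>z. nabla (frame A c b) (chart_inv ?b z) (?Z (chart_inv ?b z)) c)"
    using assms(2) unfolding smooth_section_def by blast
  then have sm: "smooth_on (coord_domain A c)
      (\<lambda>z. nabla (frame A c b) (chart_inv ?b z) (?Z (chart_inv ?b z)) c)"
    by (simp add: coord_domain_def)
  show ?thesis
    unfolding conn_form_def Let_def
    by (rule smooth_on_linear_compose[OF bounded_linear_vec_nth open_coord_domain[OF atlas assms(2)] sm])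
qed

text \<open>By the Leibniz rule a connection is determined by its values on the frames; the derivatives
  of the coefficients of a section contribute the same to both connections.\<close>

lemma same_connectionI:
  assumes con: "finsler_connection A nabla" "finsler_connection A nabla'"
    and eq: "\<And>c z a b u. c \<in> A \<Longrightarrow> z \<in> coord_domain A c \<Longrightarrow>
      conn_form A nabla c a b z u = conn_form A nabla' c a b z u"
  shows "same_connection A nabla nabla'"
  unfolding same_connection_def
proof (intro allI impI ballI, elim conjE)
  fix W s X Z
  assume W: "openin (slit_topology A) W" and s: "smooth_section A W s" and X: "X \<in> W"
    and Z: "Z \<in> tangent_space (slit_atlas A) X"
  note slit = smooth_atlas_slit[OF atlas]
  have "X \<in> points (slit_atlas A)"
    using W X openin_manifold_topology[OF slit] by blast
  then obtain c where c: "c \<in> A" "X \<in> fst (bundle_chart A c)"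
    by (auto simp: points_def slit_atlas_def)
  let ?b = "bundle_chart A c"
  note bA = bundle_chart_in_slit_atlas[OF atlas c(1)]
  note cX = charts_at_bundle_chart[OF atlas c]
  \<comment> \<open>The value \<open>nabla s X Z\<close> does not refer to an open set, so the
    comparison may be made over a smaller one that lies in a single chart.\<close>
  define W' where "W' = W \<inter> fst ?b"
  have W': "openin (slit_topology A) W'"
    unfolding W'_def by (intro openin_Int W openin_bundle_domain[OF atlas c(1)])
  have W'b: "W' \<subseteq> fst ?b" and XW': "X \<in> W'" using X c by (auto simp: W'_def)
  have cY: "c \<in> charts_at A (fst Y)" if "Y \<in> W'" for Y
    using charts_at_bundle_chart[OF atlas c(1)] that W'b by blast
  have op: "open (snd ?b ` W')"
  proof -
    have "W' \<inter> fst ?b = W'" using W'b by blast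
    then show ?thesis using openin_chart_image[OF slit W' bA] by simp
  qed
  have s': "smooth_section A W' s"
    by (rule smooth_section_subset[OF atlas s]) (simp add: W'_def)
  have sm: "smooth_on (snd ?b ` W') (\<lambda>z. s (chart_inv ?b z) c $ b)" for b
    using s c(1) by (intro smooth_on_linear_compose[OF bounded_linear_vec_nth op])
      (simp add: smooth_section_def W'_def)
  define f where "f b Y = s Y c $ b" for b Y
  \<comment> \<open>Partial sums of the expansion of \<open>s\<close> in the frame; connections add
    two sections at a time, so the sum is built up by induction on the index set.\<close>
  define t where "t B Y = tangent_of A c (fst Y) (\<Sum>b\<in>B. f b Y *\<^sub>R axis b 1)" for B Y
  have f: "smooth_fun (slit_atlas A) W' (f b)" for b
    by (rule smooth_fun_local[OF slit bA W' W'b]) (use sm in \<open>simp add: f_def o_def\<close>)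
  have t: "smooth_section A W' (t B)" for B
    unfolding t_def
    by (rule smooth_section_tangent_of[OF atlas c(1) W' W'b])
       (auto simp: f_def intro!: smooth_on_sum smooth_on_scaleR smooth_on_const op sm)
  have fr: "smooth_section A W' (frame A c b)" for b
    by (rule smooth_section_frame[OF atlas c(1) W' W'b])
  have ffr: "smooth_section A W' (\<lambda>Y. tv_scale (f b Y) (frame A c b Y))" for b
    by (rule smooth_section_cong[OF W' t[of "{b}"]])
       (simp add: t_def frame_def tangent_of_scale[OF atlas cY])
  have base: "nabla (frame A c b) X Z = nabla' (frame A c b) X Z" for b
  proof (rule tangent_space_eqI[OF atlas cX(1)])
    have "tangent_of (slit_atlas A) ?b X (Z ?b) = Z"
      by (rule tangent_of_component[OF slit cX(2) Z])
    then have comp: "nab (frame A c b) X Z c = (\<chi> a. conn_form A nab c a b (snd ?b X) (Z ?b))" for nab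
      by (simp add: conn_form_def chart_inv_bundle_chart[OF atlas c] vec_eq_iff)
    have "snd ?b X \<in> coord_domain A c" using c(2) by (simp add: coord_domain_def)
    from eq[OF c(1) this] show "nabla (frame A c b) X Z c = nabla' (frame A c b) X Z c"
      unfolding comp[of nabla] comp[of nabla'] by simp
  qed (intro finsler_in_tangent_space[OF con(1) W' fr XW' Z] finsler_in_tangent_space[OF con(2) W' fr XW' Z])+
  have scaled: "nabla (\<lambda>Y. tv_scale (h Y) (frame A c b Y)) X Z = nabla' (\<lambda>Y. tv_scale (h Y) (frame A c b Y)) X Z"
    if "smooth_fun (slit_atlas A) W' h" for h b
    using finsler_leibniz[OF con(1) W' fr XW' Z that] finsler_leibniz[OF con(2) W' fr XW' Z that] base
    by simp
  have "nabla (t B) X Z = nabla' (t B) X Z" if "finite B" for B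
    using that
  proof (induction B)
    case empty
    \<comment> \<open>The zero section is written as zero times a frame section, so that the Leibniz
      rule applies to it; the index is arbitrary.\<close>
    have 0: "t {} Y = tv_scale 0 (frame A c undefined Y)" if "Y \<in> W'" for Y
      using tangent_of_zero[OF atlas cY[OF that]] by (simp add: t_def tv_scale_def tv_zero_def)
    have z: "smooth_section A W' (\<lambda>Y. tv_scale 0 (frame A c undefined Y))"
      by (rule smooth_section_cong[OF W' t 0])
    have "smooth_fun (slit_atlas A) W' (\<lambda>_. 0)"
      by (simp add: smooth_fun_def o_def smooth_on_const)
    from scaled[OF this, of undefined] show ?case
      using finsler_cong[OF con(1) W' t XW' Z z 0] finsler_cong[OF con(2) W' t XW' Z z 0] by simp
  next
    case (insert b B)
    have i: "t (insert b B) Y = tv_add (tv_scale (f b Y) (frame A c b Y)) (t B Y)" if "Y \<in> W'" for Y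
      using insert.hyps
      by (simp add: t_def frame_def tangent_of_add[OF atlas cY[OF that]] tangent_of_scale[OF atlas cY[OF that]])
    have z: "smooth_section A W' (\<lambda>Y. tv_add (tv_scale (f b Y) (frame A c b Y)) (t B Y))"
      by (rule smooth_section_cong[OF W' t i])
    have "nab (t (insert b B)) X Z
        = tv_add (nab (\<lambda>Y. tv_scale (f b Y) (frame A c b Y)) X Z) (nab (t B) X Z)"
      if nab: "finsler_connection A nab" for nab
      using finsler_cong[OF nab W' t XW' Z z i] finsler_add[OF nab W' ffr XW' Z t] by simp
    then show ?case using con scaled[OF f] insert.IH by simp
  qed
  from this[of UNIV] have univ: "nabla (t UNIV) X Z = nabla' (t UNIV) X Z" by simp
  have st: "s Y = t UNIV Y" if "Y \<in> W'" for Y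
  proof -
    have "(\<Sum>b\<in>UNIV. f b Y *\<^sub>R axis b 1) = s Y c"
      using basis_expansion[of "s Y c"] by (simp add: f_def scalar_mult_eq_scaleR)
    then show ?thesis
      using tangent_of_component[OF atlas cY[OF that], of "s Y"] s' that
      by (simp add: t_def smooth_section_def)
  qed
  show "nabla s X Z = nabla' s X Z"
    using finsler_cong[OF con(1) W' s' XW' Z t st] finsler_cong[OF con(2) W' s' XW' Z t st] univ by simp
qed

end

text \<open>For a function homogeneous of degree 2 with vertical Hessian g, Euler's identity applied
  twice forces this value.\<close>

definition lagrangian :: "('m, 'n) pmetric \<Rightarrow> ('m, 'n) spoint \<Rightarrow> real" where
  "lagrangian g X = (1/2) * g X (liouville X) (liouville X)"

text \<open>The coefficients on the dx^d alone; vanishing torsion makes them all the coefficients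
  there are.\<close>

definition conn_coeff ::
    "('m, real^'n) chart set \<Rightarrow> ('m, 'n) fconn \<Rightarrow> ('m, real^'n) chart \<Rightarrow> 'n \<Rightarrow> 'n \<Rightarrow> 'n \<Rightarrow>
     (real^'n) \<times> (real^'n) \<Rightarrow> real" where
  "conn_coeff A nabla c a b d z = conn_form A nabla c a b z (axis d 1, 0)"

section \<open>From the global conditions to the chart hypotheses\<close>

context
  fixes A :: "('m, real^'n) chart set" and g :: "('m, 'n) pmetric" and nabla :: "('m, 'n) fconn"
  assumes atlas: "smooth_atlas A" and metric: "is_metric A g"
    and finsler: "finsler_connection A nabla" and torsion: "torsion_free A nabla"
    and homogeneity: "pos_homogeneity A g nabla"
begin

text \<open>As dx^a is closed, vanishing torsion says that \<omega>^a_d(u) v^d is symmetric in the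
  tangent vectors u and v, where v^d denotes the base components of v.\<close>

lemma conn_form_torsion_free:
  assumes "c \<in> A" "z \<in> coord_domain A c"
  shows "conn_form A nabla c a b z u = (\<Sum>d\<in>UNIV. conn_coeff A nabla c a b d z * fst u $ d)"
    and "conn_coeff A nabla c a b d z = conn_coeff A nabla c a d b z"
proof -
  let ?w = "conn_form A nabla c"
  have "frechet_derivative (\<lambda>w::(real^'n) \<times> (real^'n). fst v $ a) (at z) = (\<lambda>_. 0)" for v :: "(real^'n) \<times> (real^'n)"
    by (rule frechet_derivative_at[symmetric]) (rule has_derivative_const)
  then have ext: "extd1 (dx a) z u v = 0" for u v by (simp add: extd1_def dx_def[abs_def])
  have T: "(\<Sum>d\<in>UNIV. ?w a d z u * fst v $ d) = (\<Sum>d\<in>UNIV. ?w a d z v * fst u $ d)" for u v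
    using torsion[unfolded torsion_free_def, rule_format, OF assms, of a u v] ext
    by (simp add: torsion_def D_vec1_def wedge_def dx_def sum_subtractf)
  \<comment> \<open>For v the coordinate vector of x^b the left side isolates \<omega>^a_b(u), and
    the right side sees only the base part of u.\<close>
  have E: "?w a b z u = (\<Sum>d\<in>UNIV. ?w a d z (axis b 1, 0) * fst u $ d)" for b u
    using T[of u "(axis b 1, 0)"] by (simp add: sum_axis)
  show sym: "conn_coeff A nabla c a b d z = conn_coeff A nabla c a d b z" for b d
    unfolding conn_coeff_def using E[of b "(axis d 1, 0)"] by (simp add: sum_axis)
  have "?w a b z u = (\<Sum>d\<in>UNIV. conn_coeff A nabla c a d b z * fst u $ d)"
    using E[of b u] by (simp add: conn_coeff_def)
  then show "?w a b z u = (\<Sum>d\<in>UNIV. conn_coeff A nabla c a b d z * fst u $ d)"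
    by (simp add: sym[of _ b])
qed

lemma conn_form_horizontal:
  assumes "c \<in> A" "z \<in> coord_domain A c"
  shows "conn_form A nabla c a b z (axis d 1, w) = conn_coeff A nabla c a b d z"
    and "conn_form A nabla c a b z (0, w) = 0"
  unfolding conn_form_torsion_free(1)[OF assms] by (simp_all add: sum_axis)

lemma frechet_derivative_metric_comp:
  assumes "c \<in> A" "z \<in> coord_domain A c"
  shows "frechet_derivative (metric_comp A g c a b) (at z) u =
    (\<Sum>d\<in>UNIV. fst u $ d * pdx d (metric_comp A g c a b) z) + (\<Sum>d\<in>UNIV. snd u $ d * pdy d (metric_comp A g c a b) z)"
  by (intro frechet_derivative_partials smooth_on_differentiable[OF smooth_on_metric_comp[OF atlas metric assms(1)]
        open_coord_domain[OF atlas assms(1)] assms(2)])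

lemma Dg_vertical:
  assumes "c \<in> A" "z \<in> coord_domain A c"
  shows "Dg A g nabla c a b z (0, axis d 1) = pdy d (metric_comp A g c a b) z"
  by (simp add: Dg_def D_cov0_def conn_form_horizontal[OF assms] extd0_def pdy_def)

text \<open>\<open>N\<close> is left open here; it will be chosen so that Dy annihilates the
  vector.\<close>

lemma Dg_horizontal:
  assumes "c \<in> A" "z \<in> coord_domain A c"
  shows "Dg A g nabla c a b z (axis d 1, - (\<chi> i. N i)) =
      pdx d (metric_comp A g c a b) z - (\<Sum>i\<in>UNIV. N i * pdy i (metric_comp A g c a b) z)
      - (\<Sum>e\<in>UNIV. conn_coeff A nabla c e a d z * metric_comp A g c e b z) - (\<Sum>e\<in>UNIV. conn_coeff A nabla c e b d z * metric_comp A g c a e z)"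
  by (simp add: Dg_def D_cov0_def conn_form_horizontal[OF assms] extd0_def
      frechet_derivative_metric_comp[OF assms] sum_axis sum_negf mult.commute[of "axis d 1 $ _"])

lemma Dg_sym:
  assumes "c \<in> A" "z \<in> coord_domain A c"
  shows "Dg A g nabla c a b z u = Dg A g nabla c b a z u"
  using frechet_derivative_cong[OF open_coord_domain[OF atlas assms(1)] assms(2)
      metric_comp_sym[OF atlas metric assms(1), of _ a b]]
  by (simp add: Dg_def D_cov0_def extd0_def metric_comp_sym[OF atlas metric assms, of _ a]
      metric_comp_sym[OF atlas metric assms, of _ b])

text \<open>Since y^b Dg_ba vanishes identically, \<open>y_coord_D_cov1\<close> turns the contracted
  D^2 g into -Dy^b \<and> Dg_ba. Antisymmetry of the wedge product and symmetry of Dg make this the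
  form required by almost metric compatibility.\<close>

lemma almost_metric_compat_if_y_D2g_zero:
  assumes "y_D2g_zero A g nabla"
  shows "almost_metric_compat A g nabla"
  unfolding almost_metric_compat_def
proof (intro ballI allI)
  fix c z a u v assume c: "c \<in> A" and z: "z \<in> coord_domain A c"
  note op = open_coord_domain[OF atlas c]
  have smooth: "smooth_on (coord_domain A c) (\<lambda>w. Dg A g nabla c a b w u)" for a b u
  proof -
    have "smooth_on (coord_domain A c) (\<lambda>w. frechet_derivative (metric_comp A g c a b) (at w) u
      + (\<Sum>e\<in>UNIV. (-1) * (conn_form A nabla c e a w u * metric_comp A g c e b w))
      + (\<Sum>e\<in>UNIV. (-1) * (conn_form A nabla c e b w u * metric_comp A g c a e w)))"
      by (intro smooth_on_add smooth_on_sum smooth_on_mult op smooth_on_const smooth_on_derivative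
          smooth_on_metric_comp[OF atlas metric c] smooth_on_conn_form[OF atlas finsler c])
    then show ?thesis by (simp add: Dg_def D_cov0_def extd0_def sum_negf)
  qed
  have "(\<Sum>b\<in>UNIV. y_coord b z * D2g A g nabla c b a z u v)
      = - (\<Sum>b\<in>UNIV. wedge (Dy A nabla c b) (Dg A g nabla c b a) z u v)"
    unfolding D2g_def Dy_def
    by (rule y_coord_D_cov1[OF op z smooth_on_differentiable[OF smooth op z]])
       (rule homogeneity[unfolded pos_homogeneity_def, rule_format, OF c])
  then have "(\<Sum>b\<in>UNIV. wedge (Dy A nabla c b) (Dg A g nabla c b a) z u v) = 0"
    using assms[unfolded y_D2g_zero_def, rule_format, OF c z, of a u v] by simp
  moreover have "wedge (Dg A g nabla c a b) (Dy A nabla c b) z u v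
      = - wedge (Dy A nabla c b) (Dg A g nabla c b a) z u v" for b
    by (simp add: wedge_def Dg_sym[OF c z, of a b])
  ultimately show "(\<Sum>b\<in>UNIV. wedge (Dg A g nabla c a b) (Dy A nabla c b) z u v) = 0"
    by (simp add: sum_negf)
qed

lemma in_coords_lagrangian:
  assumes "c \<in> A" "z \<in> coord_domain A c"
  shows "in_coords A c (lagrangian g) z =
    (1/2) * (\<Sum>a\<in>UNIV. \<Sum>b\<in>UNIV. y_coord a z * y_coord b z * metric_comp A g c a b z)"
proof -
  obtain X where X: "chart_inv (bundle_chart A c) z = X" "z = (snd c (fst X), snd X c)"
    "c \<in> charts_at A (fst X)" "X \<in> slit_bundle A"
    using coord_domainE[OF atlas assms] by blast
  have "g X (snd X) (snd X) = (\<Sum>a\<in>UNIV. \<Sum>b\<in>UNIV. snd X c $ a * snd X c $ b * g X (frame A c a X) (frame A c b X))"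
    using metric_expansion[OF atlas metric X(4,3)] slit_bundle_tangent[OF atlas X(4)] by blast
  then show ?thesis
    using X by (simp add: in_coords_def lagrangian_def liouville_def metric_comp_def y_coord_def)
qed

lemma chart_metric_metric_comp:
  assumes "c \<in> A"
  shows "chart_metric (coord_domain A c) (metric_comp A g c) (in_coords A c (lagrangian g))"
proof
  fix z a d assume z: "z \<in> coord_domain A c"
  \<comment> \<open>The connection forms vanish on vertical vectors, so there Dg is the plain
    derivative of g.\<close>
  show "(\<Sum>b\<in>UNIV. y_coord b z * pdy d (metric_comp A g c b a) z) = 0"
    using homogeneity[unfolded pos_homogeneity_def, rule_format, OF assms z, of a "(0, axis d 1)"]
    by (simp add: Dg_vertical[OF assms z])
qed (use open_coord_domain[OF atlas] smooth_on_metric_comp[OF atlas metric] metric_comp_sym[OF atlas metric]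
      invertible_metric_comp[OF atlas metric] in_coords_lagrangian assms in blast)+

lemma chart_chern_conn_form:
  assumes compat: "almost_metric_compat A g nabla" and c: "c \<in> A"
  shows "chart_chern (coord_domain A c) (metric_comp A g c) (in_coords A c (lagrangian g)) (conn_coeff A nabla c)"
proof -
  interpret chart_metric "coord_domain A c" "metric_comp A g c" "in_coords A c (lagrangian g)"
    by (rule chart_metric_metric_comp[OF c])
  show ?thesis
  proof
    fix z a b d assume z: "z \<in> coord_domain A c"
    have Dy_vertical: "Dy A nabla c i z (0, axis j 1) = axis j 1 $ i" for i j
      by (simp add: Dy_def D_vec0_y_coord conn_form_horizontal[OF c z])
    show "conn_coeff A nabla c a b d z = conn_coeff A nabla c a d b z" by (rule conn_form_torsion_free(2)[OF c z])
    show "conn_coeff A nabla c a b d differentiable (at z)"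
      unfolding conn_coeff_def[abs_def]
      by (rule smooth_on_differentiable[OF smooth_on_conn_form[OF atlas finsler c] open_coord_domain[OF atlas c] z])
    \<comment> \<open>On two vertical coordinate vectors Dy^b acts as dy^b and Dg as the vertical
      derivative, so the wedge product becomes the difference of both sides.\<close>
    show "pdy d (metric_comp A g c a b) z = pdy b (metric_comp A g c a d) z"
      using compat[unfolded almost_metric_compat_def, rule_format, OF c z, of a "(0, axis d 1)" "(0, axis b 1)"]
      by (simp add: wedge_def Dy_vertical Dg_vertical[OF c z] sum_subtractf sum_axis)
    \<comment> \<open>The horizontal lift of the d-th coordinate vector is killed by every Dy^i;
      pairing it with a vertical vector in the wedge product leaves Dg on the lift alone.\<close>
    define N where "N i = (\<Sum>e\<in>UNIV. conn_coeff A nabla c i e d z * y_coord e z)" for i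
    have "Dy A nabla c i z (axis d 1, - (\<chi> i. N i)) = 0" for i
      by (simp add: Dy_def D_vec0_y_coord conn_form_horizontal[OF c z] N_def)
    then have "Dg A g nabla c a b z (axis d 1, - (\<chi> i. N i)) = 0"
      using compat[unfolded almost_metric_compat_def, rule_format, OF c z, of a "(axis d 1, - (\<chi> i. N i))" "(0, axis b 1)"]
      by (simp add: wedge_def Dy_vertical sum_axis)
    then show "pdx d (metric_comp A g c a b) z
        - (\<Sum>i\<in>UNIV. (\<Sum>e\<in>UNIV. conn_coeff A nabla c i e d z * y_coord e z) * pdy i (metric_comp A g c a b) z) =
      (\<Sum>e\<in>UNIV. conn_coeff A nabla c e a d z * metric_comp A g c e b z) + (\<Sum>e\<in>UNIV. conn_coeff A nabla c e b d z * metric_comp A g c a e z)"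
      unfolding Dg_horizontal[OF c z] by (simp add: N_def)
  qed
qed

lemma is_chern_connection_lagrangian:
  assumes "almost_metric_compat A g nabla"
  shows "is_chern_connection A (lagrangian g) nabla"
  unfolding is_chern_connection_def
proof (intro ballI allI)
  fix c z a b u assume c: "c \<in> A" and z: "z \<in> coord_domain A c"
  interpret chart_chern "coord_domain A c" "metric_comp A g c" "in_coords A c (lagrangian g)" "conn_coeff A nabla c"
    by (rule chart_chern_conn_form[OF assms c])
  show "conn_form A nabla c a b z u =
      (\<Sum>d\<in>UNIV. chern_coeff (in_coords A c (lagrangian g)) a b d z * dx d z u)"
    unfolding chern_coeff_eq[OF z] conn_form_torsion_free(1)[OF c z] dx_def ..
qed

lemma is_vertical_hessian_lagrangian: "is_vertical_hessian A g (lagrangian g)"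
  unfolding is_vertical_hessian_def
proof (intro ballI allI)
  fix c z a b assume c: "c \<in> A" and z: "z \<in> coord_domain A c"
  interpret chart_metric "coord_domain A c" "metric_comp A g c" "in_coords A c (lagrangian g)"
    by (rule chart_metric_metric_comp[OF c])
  show "metric_comp A g c a b z = vhess (in_coords A c (lagrangian g)) a b z"
    using vhess_l[OF z] by simp
qed

lemma pos_homogeneous2_lagrangian: "pos_homogeneous2 A (lagrangian g)"
  unfolding pos_homogeneous2_def
proof (intro ballI allI impI)
  fix X and s :: real assume X: "X \<in> slit_bundle A" and s: "s > 0"
  then obtain c where c: "c \<in> A" "fst X \<in> fst c"
    by (auto simp: slit_bundle_def points_def)
  interpret chart_metric "coord_domain A c" "metric_comp A g c" "in_coords A c (lagrangian g)"
    by (rule chart_metric_metric_comp[OF c(1)])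
  have cX: "c \<in> charts_at A (fst X)" using c by (simp add: charts_at_def)
  have T: "snd X \<in> tangent_space A (fst X)" by (rule slit_bundle_tangent[OF atlas X])
  have ne: "snd X c \<noteq> 0"
    using component_eq_0_iff[OF atlas cX T] X by (auto simp: slit_bundle_def)
  let ?x = "snd c (fst X)" and ?y = "snd X c"
  \<comment> \<open>Scaling by t > 0 stays in the slit bundle over the same point, so the whole ray
    lies in the chart and coordinate and global values correspond.\<close>
  have L: "in_coords A c (lagrangian g) (?x, t *\<^sub>R ?y) = lagrangian g (fst X, tv_scale t (snd X))"
    if "t > 0" for t
  proof -
    let ?Y = "(fst X, tv_scale t (snd X))"
    have tT: "tv_scale t (snd X) \<in> tangent_space A (fst X)" by (rule tangent_space_scale[OF atlas cX T])
    moreover have "tv_scale t (snd X) \<noteq> tv_zero"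
      using component_eq_0_iff[OF atlas cX tT] ne that by (simp add: tv_scale_def)
    ultimately have "?Y \<in> fst (bundle_chart A c)"
      using c X by (auto simp: fst_bundle_chart[OF atlas] slit_bundle_def)
    from chart_inv_bundle_chart[OF atlas c(1) this]
    show ?thesis by (simp add: in_coords_def snd_bundle_chart[OF atlas] tv_scale_def)
  qed
  have "in_coords A c (lagrangian g) (?x, s *\<^sub>R ?y) = s\<^sup>2 * in_coords A c (lagrangian g) (?x, ?y)"
    using c ne s by (intro l_homogeneous) (auto simp: coord_domain_eq[OF atlas c(1)])
  moreover have "(fst X, tv_scale 1 (snd X)) = X" by (simp add: tv_scale_def)
  ultimately show "lagrangian g (fst X, tv_scale s (snd X)) = s\<^sup>2 * lagrangian g X"
    using L[OF s] L[of 1] by simp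
qed

lemma smooth_fun_lagrangian: "smooth_fun (slit_atlas A) (slit_bundle A) (lagrangian g)"
  unfolding smooth_fun_def
proof
  fix b assume b: "b \<in> slit_atlas A"
  have "smooth_fun (slit_atlas A) (slit_bundle A) (\<lambda>X. g X (liouville X) (liouville X))"
    using metric openin_slit_bundle[OF atlas] smooth_section_liouville[OF atlas]
    unfolding is_metric_def by blast
  then have "smooth_on (snd b ` (slit_bundle A \<inter> fst b)) ((\<lambda>X. g X (liouville X) (liouville X)) \<circ> chart_inv b)"
    using b unfolding smooth_fun_def by blast
  then have "smooth_on (snd b ` (slit_bundle A \<inter> fst b))
      (\<lambda>z. (1/2) * ((\<lambda>X. g X (liouville X) (liouville X)) \<circ> chart_inv b) z)"
    by (intro smooth_on_mult smooth_on_const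
        openin_chart_image[OF smooth_atlas_slit[OF atlas] openin_slit_bundle[OF atlas] b])
  then show "smooth_on (snd b ` (slit_bundle A \<inter> fst b)) (lagrangian g \<circ> chart_inv b)"
    by (simp add: lagrangian_def o_def)
qed

end

theorem theorem3p20:
  fixes A :: "('m, real^'n) chart set" and g :: "('m, 'n) pmetric"
  assumes "connected_manifold A" and "is_metric A g"
  shows
    "\<forall>compat \<in> {almost_metric_compat A g, y_D2g_zero A g}.
       let P = (\<lambda>nabla. finsler_connection A nabla \<and> regular_connection A nabla \<and>
                        torsion_free A nabla \<and> pos_homogeneity A g nabla \<and> compat nabla)
       in (\<forall>nabla nabla'. P nabla \<and> P nabla' \<longrightarrow> same_connection A nabla nabla') \<and>
          (\<forall>nabla. P nabla \<longrightarrow>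
             (\<exists>L. smooth_fun (slit_atlas A) (slit_bundle A) L \<and> pos_homogeneous2 A L \<and>
                  is_vertical_hessian A g L \<and> is_chern_connection A L nabla))"
proof -
  have atlas: "smooth_atlas A" using assms(1) by (simp add: connected_manifold_def)
  \<comment> \<open>Either version of the compatibility condition leads to \<open>Q\<close>, so
    uniqueness and the properties of L are settled once for both.\<close>
  define Q where "Q nabla \<longleftrightarrow> finsler_connection A nabla \<and> torsion_free A nabla \<and>
      pos_homogeneity A g nabla \<and> almost_metric_compat A g nabla" for nabla
  have chern: "is_chern_connection A (lagrangian g) nabla" if "Q nabla" for nabla
    using that is_chern_connection_lagrangian[OF atlas assms(2)] by (simp add: Q_def)
  \<comment> \<open>Both connections are the Chern connection of the same Lagrangian, which is built
    from g alone, so their connection forms coincide.\<close>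
  have uniq: "same_connection A nabla nabla'" if "Q nabla" "Q nabla'" for nabla nabla'
  proof (rule same_connectionI[OF atlas])
    fix c z a b u assume cz: "c \<in> A" "z \<in> coord_domain A c"
    show "conn_form A nabla c a b z u = conn_form A nabla' c a b z u"
      unfolding chern[OF that(1), unfolded is_chern_connection_def, rule_format, OF cz]
        chern[OF that(2), unfolded is_chern_connection_def, rule_format, OF cz] ..
  qed (use that in \<open>simp_all add: Q_def\<close>)
  have ex: "\<exists>L. smooth_fun (slit_atlas A) (slit_bundle A) L \<and> pos_homogeneous2 A L \<and>
      is_vertical_hessian A g L \<and> is_chern_connection A L nabla" if "Q nabla" for nabla
    using that chern[OF that] smooth_fun_lagrangian[OF atlas assms(2)]
      pos_homogeneous2_lagrangian[OF atlas assms(2)] is_vertical_hessian_lagrangian[OF atlas assms(2)]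
    unfolding Q_def by blast
  have "Q nabla" if "compat \<in> {almost_metric_compat A g, y_D2g_zero A g}"
    "finsler_connection A nabla \<and> regular_connection A nabla \<and> torsion_free A nabla \<and>
      pos_homogeneity A g nabla \<and> compat nabla" for compat nabla
  proof -
    have "almost_metric_compat A g nabla"
      using that almost_metric_compat_if_y_D2g_zero[OF atlas assms(2), of nabla] by blast
    then show ?thesis using that(2) unfolding Q_def by blast
  qed
  then show ?thesis
    unfolding Let_def by (intro ballI conjI allI impI) (rule uniq ex; blast)+
qed

end
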